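(* Suppose that $\beta\in[0,1]$ and $p\in(1/2,1]$. For any $S_0\in\mathcal{D}$, $$\mathbb{E}_{\beta,p}[\tau^{6/5}\mid\xi_0=S_0]<\infty .$$
   Context: Configurations: let $\mathcal{D}'\subset\{0,1\}^{\mathbb{Z}}$ be the set of configurations with finitely many $0$'s to the left of the origin and finitely many $1$'s to the right. Call $S,S'\in\mathcal{D}'$ equivalent if they are translates of each other, and let $\mathcal{D}$ be the (countable) set of equivalence classes. So each $S\in\mathcal{D}$ is an infinite string of $1$'s, followed by a finite string of $0$'s and $1$'s, followed by an infinite string of $0$'s, modulo translation. The ground state is $\mathcal{D}_0=\ldots 111000\ldots$ (up to translation). An unlike pair is a pair of adjacent sites with labels $01$ or $10$ (read left to right); each configuration has finitely many of them and at least one. Process: for $\beta,p\in[0,1]$ the discrete-time exclusion-voter process $\xi=(\xi_t)_{t\in\mathbb{Z}^+}$, $\mathbb{Z}^+=\{0,1,2,\ldots\}$, is the time-homogeneous Markov chain on $\mathcal{D}$ with the following one-step dynamics. At each time step, independently, a voter move is chosen with probability $\beta$ and an exclusion move with probability $1-\beta$; then one of the unlike pairs of the current configuration is chosen uniformly at random. In a voter move the chosen pair is replaced by $00$ or by $11$, each with probability $1/2$. In an exclusion move, a chosen pair $01$ becomes $10$ with probability $p$ (otherwise no change), and a chosen pair $10$ becomes $01$ with probability $1-p$ (otherwise no change). Its law and expectation are denoted $\mathbb{P}_{\beta,p}$, $\mathbb{E}_{\beta,p}$. Relaxation time: $\tau=\min\{t\in\mathbb{N}:\xi_t=\mathcal{D}_0\}$,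 $\mathbb{N}=\{1,2,\ldots\}$, with $\tau=+\infty$ if there is no such $t$. *)

theory Defs
  imports "HOL-Probability.Probability"
begin

text \<open>Labels are booleans: \<^term>\<open>True\<close> is a particle (label 1), \<^term>\<open>False\<close> is a hole (label 0).\<close>

typedef config = "{s :: int \<Rightarrow> bool. finite {x. x < 0 \<and> \<not> s x} \<and> finite {x. x > 0 \<and> s x}}"
  morphisms label Config
  by (rule exI[of _ "\<lambda>x. x < 0"]) (auto simp: not_less[symmetric])

setup_lifting type_definition_config

definition translates :: "config \<Rightarrow> config \<Rightarrow> bool" where
  "translates S S' \<longleftrightarrow> (\<exists>k. \<forall>x. label S' x = label S (x + k))"

lemma equivp_translates: "equivp translates"
proof (rule equivpI)
  show "reflp translates"
    unfolding reflp_def translates_def by (metis add_0_right)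
  show "symp translates"
    unfolding symp_def translates_def
  proof (intro allI impI, elim exE)
    fix S S' k assume "\<forall>x. label S' x = label S (x + k)"
    then have "\<forall>x. label S x = label S' (x + (- k))" by simp
    then show "\<exists>k. \<forall>x. label S x = label S' (x + k)" by blast
  qed
  show "transp translates"
    unfolding transp_def translates_def by (metis add.assoc)
qed

quotient_type config_class = config / translates
  morphisms rep_class class_of
  by (rule equivp_translates)

lemma class_of_eq_iff: "class_of S = class_of S' \<longleftrightarrow> translates S S'"
  by (fact config_class.abs_eq_iff)

lift_definition ground_config :: config is "\<lambda>x::int. x < 0"
  by (auto simp: not_less[symmetric])

definition ground_state :: config_class where
  "ground_state = class_of ground_config"

text \<open>A pair of adjacent sites is represented by its left site.\<close>

definition unlike_pairs :: "config \<Rightarrow> int set" where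
  "unlike_pairs S = {x. label S x \<noteq> label S (x + 1)}"

lift_definition set_pair :: "config \<Rightarrow> int \<Rightarrow> bool \<Rightarrow> bool \<Rightarrow> config"
  is "\<lambda>s x a b. s(x := a, x + 1 := b)"
proof -
  fix s :: "int \<Rightarrow> bool" and x :: int and a b :: bool
  assume *: "finite {x. x < 0 \<and> \<not> s x} \<and> finite {x. x > 0 \<and> s x}"
  let ?s = "s(x := a, x + 1 := b)"
  have "{y. y < 0 \<and> \<not> ?s y} \<subseteq> {y. y < 0 \<and> \<not> s y} \<union> {x, x + 1}"
       "{y. y > 0 \<and> ?s y} \<subseteq> {y. y > 0 \<and> s y} \<union> {x, x + 1}"
    by auto
  with * show "finite {y. y < 0 \<and> \<not> ?s y} \<and> finite {y. y > 0 \<and> ?s y}"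
    by (meson finite.emptyI finite.insertI finite_UnI finite_subset)
qed

definition voter_move :: "config \<Rightarrow> int \<Rightarrow> config pmf" where
  "voter_move S x = map_pmf (\<lambda>b. set_pair S x b b) (bernoulli_pmf (1 / 2))"

definition exclusion_move :: "real \<Rightarrow> config \<Rightarrow> int \<Rightarrow> config pmf" where
  "exclusion_move p S x =
     (if \<not> label S x \<and> label S (x + 1)
      then map_pmf (\<lambda>c. if c then set_pair S x True False else S) (bernoulli_pmf p)
      else if label S x \<and> \<not> label S (x + 1)
      then map_pmf (\<lambda>c. if c then set_pair S x False True else S) (bernoulli_pmf (1 - p))
      else return_pmf S)"

definition config_step :: "real \<Rightarrow> real \<Rightarrow> config \<Rightarrow> config pmf" where
  "config_step \<beta> p S =
     bind_pmf (bernoulli_pmf \<beta>) (\<lambda>voter.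
     bind_pmf (pmf_of_set (unlike_pairs S)) (\<lambda>x.
       if voter then voter_move S x else exclusion_move p S x))"

text \<open>\<^const>\<open>pmf_of_set\<close> is only meaningful for finite nonempty sets.\<close>

lemma finite_unlike_pairs: "finite (unlike_pairs S)"
proof -
  define A where "A = {x. x < 0 \<and> \<not> label S x} \<union> {x. x > 0 \<and> label S x} \<union> {-1, 0}"
  have "finite A"
    using label[of S] by (simp add: A_def)
  moreover have "unlike_pairs S \<subseteq> A \<union> (\<lambda>x. x - 1) ` A"
  proof
    fix x assume "x \<in> unlike_pairs S"
    then have ne: "label S x \<noteq> label S (x + 1)" by (simp add: unlike_pairs_def)
    consider "x < -1" | "x = -1" | "x = 0" | "x > 0" by linarith
    then have "x \<in> A \<or> x + 1 \<in> A"
      by cases (use ne in \<open>auto simp: A_def\<close>)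
    then show "x \<in> A \<union> (\<lambda>x. x - 1) ` A"
      by (force simp: image_iff)
  qed
  ultimately show ?thesis
    by (meson finite_UnI finite_imageI finite_subset)
qed

lemma unlike_pairs_nonempty: "unlike_pairs S \<noteq> {}"
proof
  assume "unlike_pairs S = {}"
  then have succ: "label S (x + 1) = label S x" for x
    by (auto simp: unlike_pairs_def)
  have const: "label S x = label S 0" for x
  proof (induction x rule: int_induct[where k = 0])
    case (step1 i)
    then show ?case by (simp only: succ)
  next
    case (step2 i)
    then show ?case using succ[of "i - 1"] by simp
  qed simp
  have fin: "finite {x. x < 0 \<and> \<not> label S x}" "finite {x. x > 0 \<and> label S x}"
    using label[of S] by auto
  show False
  proof (cases "label S 0")
    case True
    then have "{x. x > 0 \<and> label S x} = {0<..}" using const by auto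
    with fin show False using infinite_Ioi[of "0::int"] by simp
  next
    case False
    then have "{x. x < 0 \<and> \<not> label S x} = {..<0}" using const by auto
    with fin show False using infinite_Iio[of "0::int"] by simp
  qed
qed

lemma class_step_translates:
  assumes "translates S S'"
  shows "map_pmf class_of (config_step \<beta> p S) = map_pmf class_of (config_step \<beta> p S')"
proof -
  from assms obtain k where k: "\<And>x. label S' x = label S (x + k)"
    unfolding translates_def by blast
  let ?U = "unlike_pairs S" and ?U' = "unlike_pairs S'"
  have U: "?U = (\<lambda>x. x + k) ` ?U'"
  proof (intro equalityI subsetI)
    fix x assume "x \<in> ?U"
    then have "x - k \<in> ?U'" by (simp add: unlike_pairs_def k)
    then show "x \<in> (\<lambda>x. x + k) ` ?U'" by (force simp: image_iff)
  qed (auto simp: unlike_pairs_def k add_ac)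
  have unif: "pmf_of_set ?U = map_pmf (\<lambda>x. x + k) (pmf_of_set ?U')"
    unfolding U by (rule map_pmf_of_set_inj[symmetric])
      (auto simp: inj_on_def unlike_pairs_nonempty finite_unlike_pairs)
  have set: "class_of (set_pair S (x + k) a b) = class_of (set_pair S' x a b)" for x a b
    unfolding class_of_eq_iff translates_def
    by (intro exI[of _ k]) (auto simp: set_pair.rep_eq k)
  have same: "class_of S = class_of S'"
    using assms by (simp add: class_of_eq_iff)
  have voter: "map_pmf class_of (voter_move S (x + k)) = map_pmf class_of (voter_move S' x)" for x
    by (simp add: voter_move_def pmf.map_comp o_def set)
  have lab: "label S (x + k + 1) = label S' (x + 1)" "label S (x + k) = label S' x" for x
    by (simp_all add: k add_ac)
  have excl: "map_pmf class_of (exclusion_move p S (x + k)) =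
      map_pmf class_of (exclusion_move p S' x)" for x
    by (simp add: exclusion_move_def pmf.map_comp o_def set same lab
        if_distrib[of class_of] if_distrib[of "map_pmf class_of"] cong: if_cong)
  show ?thesis
    by (simp add: config_step_def map_bind_pmf unif bind_map_pmf voter excl
        if_distrib[of "map_pmf class_of"] cong: if_cong)
qed

text \<open>The chain lives on translation classes, so the one-step law is projected from any representative.\<close>

lift_definition transition :: "real \<Rightarrow> real \<Rightarrow> config_class \<Rightarrow> config_class pmf"
  is "\<lambda>\<beta> p S. map_pmf class_of (config_step \<beta> p S)"
  by (rule class_step_translates)

locale exclusion_voter_process = prob_space M
  for M :: "'a measure" and \<beta> p :: real and \<xi> :: "nat \<Rightarrow> 'a \<Rightarrow> config_class" +
  assumes random_variable: "\<And>t. \<xi> t \<in> measurable M (count_space UNIV)"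
  assumes markov: "\<And>t s S'.
    \<P>(\<omega> in M. \<forall>i\<le>t. \<xi> i \<omega> = s i) > 0 \<Longrightarrow>
    \<P>(\<omega> in M. \<xi> (Suc t) \<omega> = S' \<bar> \<forall>i\<le>t. \<xi> i \<omega> = s i) = pmf (transition \<beta> p (s t)) S'"

text \<open>Such a process exists for all parameters and every deterministic initial state.\<close>

definition path_kernel :: "real \<Rightarrow> real \<Rightarrow> config_class \<Rightarrow> nat \<Rightarrow> (nat \<Rightarrow> config_class) \<Rightarrow> config_class measure" where
  "path_kernel \<beta> p S i \<omega> = measure_pmf (case i of 0 \<Rightarrow> return_pmf S | Suc j \<Rightarrow> transition \<beta> p (\<omega> j))"

lemma exclusion_voter_process_exists:
  "\<exists>M :: (nat \<Rightarrow> config_class) measure. exclusion_voter_process M \<beta> p (\<lambda>t \<omega>. \<omega> t) \<and>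
     \<P>(\<omega> in M. \<omega> 0 = S) = 1"
proof -
  let ?N = "\<lambda>_::nat. count_space (UNIV :: config_class set)"
  have m1: "(\<lambda>\<omega>. measure_pmf (transition \<beta> p (\<omega> j)))
      \<in> measurable (PiM {0..<Suc j} ?N) (subprob_algebra (count_space UNIV))" for j
    by (rule measurable_compose[OF measurable_component_singleton[of j]])
       (auto simp: space_subprob_algebra intro: prob_space_imp_subprob_space measure_pmf.prob_space_axioms)
  have m: "path_kernel \<beta> p S i \<in> measurable (PiM {0..<i} ?N) (subprob_algebra (?N i))" for i
    by (cases i) (auto simp: path_kernel_def[abs_def] space_subprob_algebra
        intro!: m1 measurable_const prob_space_imp_subprob_space measure_pmf.prob_space_axioms)
  interpret IT: Ionescu_Tulcea "path_kernel \<beta> p S" ?N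
    by standard (use m in \<open>auto simp: path_kernel_def measure_pmf.prob_space_axioms\<close>)
  define L where "L = IT.PF.lim"
  have spaceL: "space L = UNIV" and setsL: "sets L = sets (PiM UNIV ?N)"
    by (auto simp: L_def space_PiM)
  have comp: "(\<lambda>\<omega>. \<omega> t) \<in> measurable L (count_space UNIV)" for t
    unfolding measurable_cong_sets[OF setsL refl] by (rule measurable_component_singleton) simp
  have cyl: "emeasure L {\<omega>. \<forall>i<n. \<omega> i = s i} =
      emeasure (IT.C 0 n (\<lambda>_. undefined)) (\<Pi>\<^sub>E i\<in>{0..<n}. {s i})" for n s
  proof -
    let ?X = "\<Pi>\<^sub>E i\<in>{0..<n}. {s i}"
    have X: "?X \<in> sets (PiM {0..<n} ?N)" by (rule sets_PiM_I_finite) auto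
    have "IT.PF.emb UNIV {0..<n} ?X = {\<omega>. \<forall>i<n. \<omega> i = s i}"
      by (auto simp: prod_emb_def space_PiM PiE_iff restrict_def)
    moreover have "IT.PF.emb {0..<n} {0..<n} ?X = ?X"
      using X by (simp add: prod_emb_id sets.sets_into_space space_PiM PiE_mono)
    ultimately show ?thesis
      using IT.lim[OF _ X] IT.emeasure_CI[of "{0..<n}" n, OF _ X] by (simp add: L_def)
  qed
  have "emeasure L UNIV = 1"
    using cyl[of 0 undefined] by (simp add: space_PiM PiM_empty)
  then interpret L: prob_space L
    by (intro prob_spaceI) (simp add: spaceL)
  have rec: "emeasure L {\<omega>. \<forall>i<Suc n. \<omega> i = s i} =
      emeasure (path_kernel \<beta> p S n s) {s n} * emeasure L {\<omega>. \<forall>i<n. \<omega> i = s i}" for n s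
  proof -
    let ?X = "\<lambda>n. \<Pi>\<^sub>E i\<in>{0..<n}. {s i}" and ?C = "IT.C 0 n (\<lambda>_. undefined)"
    have u: "(\<lambda>_. undefined) \<in> space (PiM {0..<0} ?N)" by (simp add: space_PiM)
    have X: "?X n \<in> sets (PiM {0..<n} ?N)" for n by (rule sets_PiM_I_finite) auto
    have sC: "sets ?C = sets (PiM {0..<n} ?N)" "space ?C = space (PiM {0..<n} ?N)"
      using IT.sets_C[OF u, of n] IT.space_C[OF u, of n] by simp_all
    have eP: "IT.eP n \<in> measurable ?C (subprob_algebra (PiM {0..<Suc n} ?N))"
      using IT.measurable_eP[of n] by (simp cong: measurable_cong_sets add: sC measurable_cong_sets[OF sC(1) refl])
    have "emeasure (IT.C 0 (Suc n) (\<lambda>_. undefined)) (?X (Suc n)) =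
        (\<integral>\<^sup>+\<omega>. emeasure (IT.eP n \<omega>) (?X (Suc n)) \<partial>?C)"
      using IT.prob_space_C[OF u, of n]
      by (simp add: emeasure_bind[OF prob_space.not_empty _ X] eP)
    also have "\<dots> = (\<integral>\<^sup>+\<omega>. emeasure (path_kernel \<beta> p S n s) {s n} * indicator (?X n) \<omega> \<partial>?C)"
    proof (rule nn_integral_cong)
      fix \<omega> assume w: "\<omega> \<in> space ?C"
      then have w': "\<omega> \<in> space (PiM {0..<n} ?N)" by (simp add: sC)
      then have ext: "\<omega> \<in> extensional {0..<n}" by (simp add: space_PiM PiE_def)
      show "emeasure (IT.eP n \<omega>) (?X (Suc n)) =
          emeasure (path_kernel \<beta> p S n s) {s n} * indicator (?X n) \<omega>"
      proof (cases "\<omega> \<in> ?X n")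
        case True
        then have eq: "\<omega> i = s i" if "i < n" for i using that by (auto simp: PiE_iff)
        have "(fun_upd \<omega> n) -` ?X (Suc n) \<inter> space (?N n) = {s n}"
          using ext by (auto simp: PiE_iff eq extensional_def less_Suc_eq split: if_splits)
        moreover have "path_kernel \<beta> p S n \<omega> = path_kernel \<beta> p S n s"
          by (auto simp: path_kernel_def eq split: nat.split)
        ultimately show ?thesis
          using True by (simp add: IT.emeasure_eP[OF w' X])
      next
        case False
        then obtain i where "i < n" "\<omega> i \<noteq> s i" using ext by (auto simp: PiE_iff)
        then have "(fun_upd \<omega> n) -` ?X (Suc n) \<inter> space (?N n) = {}"
          by (auto simp: PiE_iff) (metis atLeastLessThan_iff fun_upd_other less_Suc_eq less_irrefl zero_le)
        with False show ?thesis by (simp add: IT.emeasure_eP[OF w' X])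
      qed
    qed
    also have "\<dots> = emeasure (path_kernel \<beta> p S n s) {s n} * emeasure ?C (?X n)"
      by (subst nn_integral_cmult_indicator) (simp_all add: sC X)
    finally show ?thesis unfolding cyl .
  qed
  have mkv: "\<P>(\<omega> in L. \<omega> (Suc t) = S' \<bar> \<forall>i\<le>t. \<omega> i = s i) = pmf (transition \<beta> p (s t)) S'"
    if pos: "\<P>(\<omega> in L. \<forall>i\<le>t. \<omega> i = s i) > 0" for t s S'
  proof -
    let ?s = "fun_upd s (Suc t) S'"
    have "{\<omega>. \<omega> (Suc t) = S' \<and> (\<forall>i\<le>t. \<omega> i = s i)} = {\<omega>. \<forall>i<Suc (Suc t). \<omega> i = ?s i}"
      by (auto simp: less_Suc_eq_le le_Suc_eq)
    moreover have "{\<omega>. \<forall>i\<le>t. \<omega> i = s i} = {\<omega>. \<forall>i<Suc t. \<omega> i = ?s i}"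
      by (auto simp: less_Suc_eq_le)
    moreover have "emeasure (path_kernel \<beta> p S (Suc t) ?s) {?s (Suc t)} = pmf (transition \<beta> p (s t)) S'"
      by (simp add: path_kernel_def emeasure_pmf_single)
    ultimately have "emeasure L {\<omega>. \<omega> (Suc t) = S' \<and> (\<forall>i\<le>t. \<omega> i = s i)} =
        pmf (transition \<beta> p (s t)) S' * emeasure L {\<omega>. \<forall>i\<le>t. \<omega> i = s i}"
      using rec[of "Suc t" ?s] by simp
    then have "measure L {\<omega>. \<omega> (Suc t) = S' \<and> (\<forall>i\<le>t. \<omega> i = s i)} =
        pmf (transition \<beta> p (s t)) S' * measure L {\<omega>. \<forall>i\<le>t. \<omega> i = s i}"
      by (simp add: measure_def enn2real_mult)
    with pos show ?thesis by (simp add: cond_prob_def spaceL)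
  qed
  have "emeasure L {\<omega>. \<omega> 0 = S} = 1"
    using rec[of 0 "\<lambda>_. S"] L.emeasure_space_1 by (simp add: path_kernel_def emeasure_pmf_single spaceL)
  then have "\<P>(\<omega> in L. \<omega> 0 = S) = 1"
    by (simp add: measure_def spaceL)
  moreover have "exclusion_voter_process L \<beta> p (\<lambda>t \<omega>. \<omega> t)"
    by unfold_locales (fact comp, fact mkv)
  ultimately show ?thesis by blast
qed

definition relaxation_time :: "(nat \<Rightarrow> config_class) \<Rightarrow> enat" where
  "relaxation_time X =
     (if \<exists>t\<ge>1. X t = ground_state then enat (LEAST t. t \<ge> 1 \<and> X t = ground_state) else \<infinity>)"

definition enat_powr :: "enat \<Rightarrow> real \<Rightarrow> ennreal" where
  "enat_powr n a = (case n of enat k \<Rightarrow> ennreal (real k powr a) | \<infinity> \<Rightarrow> \<infinity>)"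

text \<open>Elementary conditioning on an event of positive probability; the value may be \<open>\<infinity>\<close>.\<close>

definition cond_nn_expectation :: "'a measure \<Rightarrow> ('a \<Rightarrow> ennreal) \<Rightarrow> ('a \<Rightarrow> bool) \<Rightarrow> ennreal" where
  "cond_nn_expectation M f Q = (\<integral>\<^sup>+\<omega>. f \<omega> \<partial>uniform_measure M {\<omega> \<in> space M. Q \<omega>})"

end

theory Submission
  imports Defs
begin

text \<open>The proof rests on two statistics of a configuration. Let \<open>Z k\<close> be the number of zeros up to \<open>k\<close> and
  \<open>W k\<close> the number of ones after \<open>k\<close>. The number of inversions is \<open>\<Sum>k. min (Z k) (W k)\<close>, and the inversion
  span \<open>\<Sum>k. Z k * W k\<close> is the total distance over all inversions. Both vanish exactly in the ground state.

  Write \<open>N\<close> for the number of \<open>01\<close> pairs, so that there are \<open>N + 1\<close> pairs \<open>10\<close>. The height \<open>Z + W\<close> has the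
  same sum \<open>H\<close> over the \<open>01\<close> pairs and over the \<open>10\<close> pairs (\<open>sum_height_descents\<close>). Therefore the span is a
  martingale under voter moves, while an exclusion move changes it on average by
  \<open>(- (2 * p - 1) * H + N + (1 - p)) / (2 * N + 1)\<close>. Since the span is at most \<open>H ^ 3\<close> and
  \<open>N ^ 2 \<le> H\<close>, the quotient \<open>H / (2 * N + 1)\<close> is at least of order \<open>span powr (1 / 6)\<close>
  (\<open>inversion_span_le_height_ratio\<close>).

  For \<open>\<beta> < 1\<close> the span, with a bounded correction for small configurations, is thus a function \<open>F\<close> that
  loses at least \<open>c * F powr (1 / 6)\<close> on average in each step outside the ground state. For \<open>\<beta> = 1\<close>
  the span has no drift, but the number of inversions loses at least \<open>1 / 3\<close>, and
  \<open>F = inversions powr (3 / 5) * span powr (2 / 5)\<close> has the same kind of drift; here the bound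
  \<open>inversions \<le> 4 * span powr (2 / 3)\<close> (\<open>inversions_le_span\<close>) enters.

  Such a drift yields the moment of order \<open>q = 6 / 5\<close>, where \<open>1 / 6 = 1 - 1 / q\<close>: the process
  \<open>(e * t + F powr (1 / q)) powr q\<close> is a supermartingale up to the relaxation time, because this expression is
  concave in \<open>F\<close>, and its final value is at least \<open>(e * \<tau>) powr q\<close> (\<open>relaxation_moment_if_drift\<close>).\<close>

section \<open>Laws of finite histories\<close>

text \<open>Countability makes every set of finite histories measurable, so that the law of a history is
  determined by the probabilities of single histories.\<close>

lemma countable_config_class: "countable (UNIV :: config_class set)"
proof -
  let ?e = "\<lambda>S. ({x. x < 0 \<and> \<not> label S x}, {x. x > 0 \<and> label S x}, label S 0)"
  have "inj ?e"
  proof (rule injI)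
    fix S S' assume e: "?e S = ?e S'"
    have "label S x = label S' x" for x
      using e by (cases x "0::int" rule: linorder_cases) auto
    then show "S = S'" by (simp add: label_inject[symmetric] fun_eq_iff)
  qed
  moreover have "range ?e \<subseteq> {A. finite A} \<times> {A. finite A} \<times> UNIV"
    using label by auto
  moreover have "countable ({A::int set. finite A} \<times> {A::int set. finite A} \<times> (UNIV::bool set))"
    by (intro countable_SIGMA countable_Collect_finite) auto
  ultimately have "countable (UNIV :: config set)"
    using countable_subset countable_image_inj_eq by fast
  then have "countable (range class_of)" by simp
  moreover have "c \<in> range class_of" for c
    by (induction c) auto
  ultimately show ?thesis
    by (metis UNIV_eq_I)
qed

text \<open>Histories are lists with the newest state first, so that one step of the chain is a cons.\<close>

fun history :: "('s \<Rightarrow> 's pmf) \<Rightarrow> 's \<Rightarrow> nat \<Rightarrow> 's list pmf" where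
  "history K S 0 = return_pmf [S]"
| "history K S (Suc n) = bind_pmf (history K S n) (\<lambda>l. map_pmf (\<lambda>s. s # l) (K (hd l)))"

lemma length_history: "l \<in> set_pmf (history K S n) \<Longrightarrow> length l = Suc n"
  by (induction n arbitrary: l) auto

lemma pmf_history_Cons:
  "pmf (history K S (Suc n)) (s # l) = pmf (history K S n) l * pmf (K (hd l)) s"
proof -
  have "pmf (map_pmf (\<lambda>s. s # l') (K (hd l'))) (s # l) = indicator {l} l' * pmf (K (hd l)) s" for l'
  proof (cases "l' = l")
    case True
    then show ?thesis
      using pmf_map_inj'[of "\<lambda>s. s # l" "K (hd l)" s] by (simp add: inj_def)
  next
    case False
    then show ?thesis by (auto simp: pmf_eq_0_set_pmf)
  qed
  then show ?thesis by (simp add: pmf_bind measure_pmf_single)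
qed

text \<open>The order is reversed to match the histories above.\<close>

definition trajectory :: "(nat \<Rightarrow> 's) \<Rightarrow> nat \<Rightarrow> 's list" where
  "trajectory X n = map X (rev [0..<Suc n])"

lemma trajectory_0: "trajectory X 0 = [X 0]"
  by (simp add: trajectory_def)

lemma trajectory_Suc: "trajectory X (Suc n) = X (Suc n) # trajectory X n"
  by (simp add: trajectory_def)

lemma length_trajectory: "length (trajectory X n) = Suc n"
  by (simp add: trajectory_def)

lemma hd_trajectory: "hd (trajectory X n) = X n"
  by (cases n) (simp_all add: trajectory_def)

lemma trajectory_eq_iff: "trajectory X n = trajectory Y n \<longleftrightarrow> (\<forall>i\<le>n. X i = Y i)"
  by (auto simp: trajectory_def)

lemma trajectory_surj: "length l = Suc n \<Longrightarrow> \<exists>Y. l = trajectory Y n"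
proof (induction n arbitrary: l)
  case 0
  then obtain s where "l = [s]" by (auto simp: length_Suc_conv)
  then have "l = trajectory (\<lambda>_. s) 0" by (simp add: trajectory_0)
  then show ?case by blast
next
  case (Suc n)
  then obtain s l' where l: "l = s # l'" "length l' = Suc n" by (auto simp: length_Suc_conv)
  then obtain Y where Y: "l' = trajectory Y n" using Suc.IH by blast
  have "trajectory (Y(Suc n := s)) n = trajectory Y n" by (simp add: trajectory_eq_iff)
  then have "l = trajectory (Y(Suc n := s)) (Suc n)" by (simp add: l Y trajectory_Suc)
  then show ?case by blast
qed

text \<open>The Markov property fixes the conditional law of the next state given each single history of
  positive probability; multiplying these factors identifies the law of the whole history with the
  distribution that the transition kernel generates.\<close>

context exclusion_voter_process
begin

lemma trajectory_sets: "{\<omega>\<in>space M. trajectory (\<lambda>t. \<xi> t \<omega>) n = l} \<in> sets M"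
proof (induction n arbitrary: l)
  case 0
  have "{\<omega>\<in>space M. \<xi> 0 \<omega> = s} \<in> sets M" for s
    using measurable_sets[OF random_variable[of 0], of "{s}"]
    by (simp add: vimage_def Int_def conj_commute)
  moreover have "{\<omega>\<in>space M. trajectory (\<lambda>t. \<xi> t \<omega>) 0 = l} = (if l = [hd l] then {\<omega>\<in>space M. \<xi> 0 \<omega> = hd l} else {})"
    by (auto simp: trajectory_0)
  ultimately show ?case by simp
next
  case (Suc n)
  show ?case
  proof (cases l)
    case Nil
    then show ?thesis by (simp add: trajectory_Suc)
  next
    case (Cons s l')
    have "{\<omega>\<in>space M. \<xi> (Suc n) \<omega> = s} \<in> sets M"
      using measurable_sets[OF random_variable[of "Suc n"], of "{s}"]
      by (simp add: vimage_def Int_def conj_commute)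
    with Suc[of l'] have "{\<omega>\<in>space M. \<xi> (Suc n) \<omega> = s} \<inter> {\<omega>\<in>space M. trajectory (\<lambda>t. \<xi> t \<omega>) n = l'} \<in> sets M"
      by blast
    moreover have "{\<omega>\<in>space M. trajectory (\<lambda>t. \<xi> t \<omega>) (Suc n) = l} = {\<omega>\<in>space M. \<xi> (Suc n) \<omega> = s} \<inter> {\<omega>\<in>space M. trajectory (\<lambda>t. \<xi> t \<omega>) n = l'}"
      by (auto simp: Cons trajectory_Suc)
    ultimately show ?thesis by simp
  qed
qed

lemma trajectory_measurable: "(\<lambda>\<omega>. trajectory (\<lambda>t. \<xi> t \<omega>) n) \<in> measurable M (count_space UNIV)"
proof -
  have "countable (UNIV :: config_class list set)"
    using countable_lists[OF countable_config_class] by simp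
  then show ?thesis
    using trajectory_sets[of n]
    by (subst measurable_count_space_eq_countable) (auto simp: vimage_def Int_def conj_commute)
qed

lemma trajectory_step:
  "measure M {\<omega>\<in>space M. trajectory (\<lambda>t. \<xi> t \<omega>) (Suc n) = s # l}
   = measure M {\<omega>\<in>space M. trajectory (\<lambda>t. \<xi> t \<omega>) n = l} * pmf (transition \<beta> p (hd l)) s"
proof (cases "length l = Suc n")
  case True
  then obtain Y where l: "l = trajectory Y n" using trajectory_surj by blast
  define P where "P = \<P>(\<omega> in M. \<forall>i\<le>n. \<xi> i \<omega> = Y i)"
  define Q where "Q = \<P>(\<omega> in M. \<xi> (Suc n) \<omega> = s \<and> (\<forall>i\<le>n. \<xi> i \<omega> = Y i))"
  have le: "Q \<le> P"
    unfolding P_def Q_def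
  proof (rule finite_measure_mono)
    show "{\<omega>\<in>space M. \<forall>i\<le>n. \<xi> i \<omega> = Y i} \<in> sets M"
      using trajectory_sets[of n "trajectory Y n"] unfolding trajectory_eq_iff .
  qed blast
  have nonneg: "0 \<le> P" "0 \<le> Q" by (simp_all add: P_def Q_def)
  have "0 < P \<Longrightarrow> Q / P = pmf (transition \<beta> p (Y n)) s"
    using markov[of n Y s] unfolding cond_prob_def P_def Q_def by assumption
  then have "Q = P * pmf (transition \<beta> p (Y n)) s"
    using le nonneg by (cases "P = 0") (auto simp: field_simps)
  then show ?thesis
    unfolding l trajectory_Suc trajectory_eq_iff hd_trajectory P_def Q_def list.inject .
next
  case False
  then have "trajectory X (Suc n) \<noteq> s # l" "trajectory X n \<noteq> l" for X :: "nat \<Rightarrow> config_class"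
    using length_trajectory[of X n] by (auto simp: trajectory_Suc simp del: length_trajectory)
  then show ?thesis by simp
qed

lemma distr_trajectory:
  assumes pos: "\<P>(\<omega> in M. \<xi> 0 \<omega> = S) > 0"
  defines "N \<equiv> uniform_measure M {\<omega>\<in>space M. \<xi> 0 \<omega> = S}"
  shows "distr N (count_space UNIV) (\<lambda>\<omega>. trajectory (\<lambda>t. \<xi> t \<omega>) n) = measure_pmf (history (transition \<beta> p) S n)"
proof (rule measure_eqI_countable[where A=UNIV])
  let ?A = "{\<omega>\<in>space M. \<xi> 0 \<omega> = S}"
  let ?T = "\<lambda>n l. {\<omega>\<in>space M. trajectory (\<lambda>t. \<xi> t \<omega>) n = l}"
  have A: "?A \<in> sets M"
    using trajectory_sets[of 0 "[S]"] by (simp add: trajectory_0)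
  have last: "last (trajectory X m) = X 0" for X :: "nat \<Rightarrow> config_class" and m
    by (simp add: trajectory_def last_map last_rev)
  have meas: "measure M (?A \<inter> ?T m l) = measure M ?A * pmf (history (transition \<beta> p) S m) l" for m l
  proof (induction m arbitrary: l)
    case 0
    have "?A \<inter> ?T 0 l = (if l = [S] then ?A else {})" by (auto simp: trajectory_0)
    then show ?case by (auto simp: indicator_def)
  next
    case (Suc m)
    show ?case
    proof (cases l)
      case Nil
      then have "pmf (history (transition \<beta> p) S (Suc m)) l = 0"
        using length_history[of "[]" "transition \<beta> p" S "Suc m"] by (auto simp: pmf_eq_0_set_pmf)
      then show ?thesis by (simp add: Nil trajectory_Suc)
    next
      case (Cons s l')
      have eq: "?A \<inter> ?T j l = (if last l = S then ?T j l else {})" for j l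
        by (auto simp: last)
      have "measure M (?A \<inter> ?T (Suc m) l) = measure M (?A \<inter> ?T m l') * pmf (transition \<beta> p (hd l')) s"
      proof (cases "l' = []")
        case True
        have ne: "trajectory X m \<noteq> []" for X :: "nat \<Rightarrow> config_class"
          using length_trajectory[of X m] by auto
        show ?thesis unfolding True Cons trajectory_Suc by (simp add: ne)
      next
        case False
        then show ?thesis
          unfolding eq Cons by (simp only: last_ConsR trajectory_step split: if_split) simp
      qed
      then show ?thesis unfolding Suc Cons pmf_history_Cons by (simp only: mult.assoc)
    qed
  qed
  have TN: "(\<lambda>\<omega>. trajectory (\<lambda>t. \<xi> t \<omega>) n) \<in> measurable N (count_space UNIV)"
    using trajectory_measurable[of n] by (simp add: N_def)
  show "emeasure (distr N (count_space UNIV) (\<lambda>\<omega>. trajectory (\<lambda>t. \<xi> t \<omega>) n)) {l} =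
        emeasure (measure_pmf (history (transition \<beta> p) S n)) {l}" for l
  proof -
    have "(\<lambda>\<omega>. trajectory (\<lambda>t. \<xi> t \<omega>) n) -` {l} \<inter> space N = ?T n l"
      by (auto simp: N_def)
    then have "emeasure (distr N (count_space UNIV) (\<lambda>\<omega>. trajectory (\<lambda>t. \<xi> t \<omega>) n)) {l} = emeasure N (?T n l)"
      by (simp add: emeasure_distr[OF TN])
    also have "\<dots> = emeasure M (?A \<inter> ?T n l) / emeasure M ?A"
      unfolding N_def using A trajectory_sets by (intro emeasure_uniform_measure) auto
    also have "\<dots> = ennreal (pmf (history (transition \<beta> p) S n) l)"
      using pos by (simp add: emeasure_eq_measure meas divide_ennreal)
    finally show ?thesis by (simp add: emeasure_pmf_single)
  qed
qed (use countable_lists[OF countable_config_class] in auto)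

end

section \<open>Moments of the relaxation time from a drift condition\<close>

text \<open>The convex function \<open>x powr q\<close> lies above its tangent at \<open>y\<close>; in this form it is Young's
  inequality for \<open>x\<close> and \<open>y powr (q - 1)\<close>.\<close>

lemma powr_tangent:
  fixes x y q :: real
  assumes "0 \<le> x" "0 < y" "1 \<le> q"
  shows "y powr q + q * y powr (q - 1) * (x - y) \<le> x powr q"
proof (cases "x = 0")
  case True
  have "y powr q = y powr (q - 1) * y" using assms by (simp add: powr_diff)
  moreover have "0 \<le> y powr (q - 1) * y * (q - 1)" using assms by simp
  ultimately show ?thesis using assms True by (simp add: algebra_simps)
next
  case False
  then have x: "0 < x" using assms by simp
  have yq: "y powr q = y powr (q - 1) * y" using assms by (simp add: powr_diff)
  have "(x powr q) powr (1/q) * (y powr q) powr (1 - 1/q) \<le> (1/q) * x powr q + (1 - 1/q) * y powr q"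
    using assms x by (intro Youngs_inequality_0) (auto simp: field_simps)
  also have "(x powr q) powr (1/q) * (y powr q) powr (1 - 1/q) = x * y powr (q - 1)"
    using assms x by (simp add: powr_powr right_diff_distrib)
  finally have "q * (x * y powr (q - 1)) \<le> q * ((1/q) * x powr q + (1 - 1/q) * y powr q)"
    using assms by (intro mult_left_mono) auto
  also have "\<dots> = x powr q + (q - 1) * y powr q" using assms by (simp add: field_simps)
  finally show ?thesis using yq by (simp add: algebra_simps)
qed

text \<open>For \<open>q \<ge> 1\<close> the function \<open>x \<mapsto> (a + x powr (1 / q)) powr q\<close> is concave, hence below its tangent
  at \<open>y\<close>. After dividing by \<open>B powr q\<close> this is Jensen's inequality for \<open>u powr q\<close>
  with the weights \<open>l\<close> and \<open>m\<close> at the points \<open>1\<close> and \<open>u\<close>.\<close>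

lemma powr_sum_tangent:
  fixes a x y q :: real
  assumes a: "0 \<le> a" and x: "0 \<le> x" and y: "0 < y" and q: "1 \<le> q"
  defines "B \<equiv> a + y powr (1 / q)"
  shows "(a + x powr (1 / q)) powr q \<le> B powr q + B powr (q - 1) * y powr (1 / q - 1) * (x - y)"
proof -
  define u where "u = (x / y) powr (1 / q)"
  define l m where "l = a / B" and "m = y powr (1 / q) / B"
  have B: "0 < B" using a y by (simp add: B_def add_nonneg_pos)
  have lm: "0 \<le> l" "0 < m" "l + m = 1"
    using a y B by (auto simp: l_def m_def B_def add_divide_distrib[symmetric])
  have u: "0 \<le> u" "u powr q = x / y"
    using x y q by (auto simp: u_def powr_powr)
  define w where "w = l + m * u"
  have "(w powr q) \<le> l + m * u powr q"
  proof (cases "w = 0")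
    case True
    then show ?thesis using lm by simp
  next
    case False
    then have w: "0 < w" using lm u by (simp add: w_def less_le)
    have "l * (w powr q + q * w powr (q - 1) * (1 - w)) \<le> l * 1 powr q"
      using powr_tangent[of 1 w q] w q lm by (intro mult_left_mono) auto
    moreover have "m * (w powr q + q * w powr (q - 1) * (u - w)) \<le> m * u powr q"
      using powr_tangent[of u w q] w q lm u by (intro mult_left_mono) auto
    moreover have "l * (w powr q + q * w powr (q - 1) * (1 - w)) + m * (w powr q + q * w powr (q - 1) * (u - w))
      = (l + m) * w powr q + q * w powr (q - 1) * (l + m * u - (l + m) * w)"
      by (simp add: algebra_simps)
    ultimately have "(l + m) * w powr q + q * w powr (q - 1) * (l + m * u - (l + m) * w) \<le> l * 1 powr q + m * u powr q"
      by linarith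
    then show ?thesis using lm(3) by (simp add: w_def)
  qed
  then have "B powr q * w powr q \<le> B powr q * (l + m * (x / y))"
    using u by (intro mult_left_mono) auto
  moreover have "B * w = a + x powr (1 / q)"
    using B x y by (simp add: w_def l_def m_def u_def powr_divide field_simps)
  then have "B powr q * w powr q = (a + x powr (1 / q)) powr q"
    using B lm u by (simp add: w_def powr_mult[symmetric])
  moreover have "l + m * (x / y) = 1 + m * ((x - y) / y)"
    using lm(3) y by (simp add: diff_divide_distrib right_diff_distrib)
  then have "B powr q * (l + m * (x / y)) = B powr q * (1 + m * ((x - y) / y))"
    by simp
  moreover have "B powr q * (1 + m * ((x - y) / y)) = B powr q + B powr (q - 1) * y powr (1 / q - 1) * (x - y)"
    using B y by (simp add: m_def powr_diff field_simps)
  ultimately show ?thesis by metis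
qed

text \<open>A drift of order \<open>f powr (1 - 1 / q)\<close> makes \<open>f powr (1 / q)\<close> decrease at a constant speed. Adding a
  clock of speed \<open>e \<le> c / q\<close> keeps the sum from increasing, and this remains true for the
  expectation of its \<open>q\<close>-th power: the power is concave as a function of \<open>f\<close>, so that its expectation
  is controlled by the expectation of \<open>f\<close> alone, without any second moment.\<close>

lemma drift_with_clock:
  fixes K :: "'s pmf" and F :: "'s \<Rightarrow> real" and f c q e t :: real
  assumes fin: "finite (set_pmf K)" and F: "\<And>s. 0 \<le> F s" and f: "0 < f" and q: "1 \<le> q"
    and drift: "measure_pmf.expectation K F \<le> f - c * f powr (1 - 1 / q)"
    and e: "0 \<le> e" "q * e \<le> c" and t: "0 \<le> t"
  shows "measure_pmf.expectation K (\<lambda>s. (e * (t + 1) + F s powr (1 / q)) powr q)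
    \<le> (e * t + f powr (1 / q)) powr q"
proof -
  define B where "B = e * (t + 1) + f powr (1 / q)"
  define d where "d = B powr (q - 1) * f powr (1 / q - 1)"
  have et: "0 \<le> e * t" "0 \<le> e * (t + 1)" using e t by auto
  have B: "0 < B" using et f by (simp add: B_def add_nonneg_pos)
  note int = integrable_measure_pmf_finite[OF fin]
  have "measure_pmf.expectation K (\<lambda>s. (e * (t + 1) + F s powr (1 / q)) powr q)
      \<le> measure_pmf.expectation K (\<lambda>s. B powr q + d * (F s - f))"
    unfolding B_def d_def using powr_sum_tangent[OF et(2) F f q] by (intro integral_mono int)
  also have "\<dots> = B powr q + d * (measure_pmf.expectation K F - f)"
    by (simp add: int)
  also have "\<dots> \<le> B powr q + d * (- c * f powr (1 - 1 / q))"
    using drift by (intro add_left_mono mult_left_mono) (auto simp: d_def)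
  also have "d * (- c * f powr (1 - 1 / q)) = - c * B powr (q - 1)"
    using f by (simp add: d_def powr_add[symmetric])
  also have "B powr q + - c * B powr (q - 1) \<le> B powr q + q * B powr (q - 1) * (- e)"
    using mult_right_mono[OF e(2), of "B powr (q - 1)"] by (simp add: algebra_simps)
  also have "\<dots> \<le> (e * t + f powr (1 / q)) powr q"
    using powr_tangent[of "e * t + f powr (1 / q)" B q] et B q by (simp add: B_def algebra_simps)
  finally show ?thesis .
qed

text \<open>The value of \<open>\<Phi>\<close> at the first visit to \<open>g\<close>, or at the present if \<open>g\<close> has not been visited. The
  last list entry is the initial state, which does not count as a visit; hence the \<open>butlast\<close>.\<close>

fun stopped_value :: "(nat \<Rightarrow> 's \<Rightarrow> real) \<Rightarrow> 's \<Rightarrow> 's list \<Rightarrow> real" where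
  "stopped_value \<Phi> g [] = 0"
| "stopped_value \<Phi> g (s # l) =
     (if g \<in> set (butlast l) then stopped_value \<Phi> g l else \<Phi> (length l) s)"

text \<open>The bound starts from the law after one step, because the initial state may itself be \<open>g\<close>, where
  no drift is assumed.\<close>

lemma stopped_value_supermartingale:
  fixes \<Phi> :: "nat \<Rightarrow> 's \<Rightarrow> real"
  assumes fin: "\<And>s. finite (set_pmf (K s))"
    and nonneg: "\<And>t s. 0 \<le> \<Phi> t s"
    and drift: "\<And>t s. s \<noteq> g \<Longrightarrow> measure_pmf.expectation (K s) (\<Phi> (Suc t)) \<le> \<Phi> t s"
  shows "(\<integral>\<^sup>+l. stopped_value \<Phi> g l \<partial>history K S (Suc n)) \<le> (\<integral>\<^sup>+s. \<Phi> 1 s \<partial>K S)"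
proof (induction n)
  case 0
  then show ?case by simp
next
  case (Suc n)
  have "(\<integral>\<^sup>+l. stopped_value \<Phi> g l \<partial>history K S (Suc (Suc n)))
      = (\<integral>\<^sup>+l. \<integral>\<^sup>+s. stopped_value \<Phi> g (s # l) \<partial>K (hd l) \<partial>history K S (Suc n))"
    by (subst history.simps) simp
  also have "\<dots> \<le> (\<integral>\<^sup>+l. stopped_value \<Phi> g l \<partial>history K S (Suc n))"
  proof (rule nn_integral_mono_AE, rule AE_pmfI)
    fix l assume "l \<in> set_pmf (history K S (Suc n))"
    then have len: "length l = Suc (Suc n)" by (rule length_history)
    then obtain s l' where l: "l = s # l'" "length l' = Suc n" by (auto simp: length_Suc_conv)
    show "(\<integral>\<^sup>+s. stopped_value \<Phi> g (s # l) \<partial>K (hd l)) \<le> ennreal (stopped_value \<Phi> g l)"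
    proof (cases "g \<in> set (butlast l)")
      case True
      then show ?thesis by simp
    next
      case False
      have "l' \<noteq> []" using l by auto
      with False have "s \<noteq> g" "g \<notin> set (butlast l')" by (auto simp: l)
      have "(\<integral>\<^sup>+s. stopped_value \<Phi> g (s # l) \<partial>K (hd l)) = (\<integral>\<^sup>+s'. \<Phi> (Suc (length l')) s' \<partial>K s)"
        using False by (simp add: l del: butlast.simps)
      also have "\<dots> = ennreal (measure_pmf.expectation (K s) (\<Phi> (Suc (length l'))))"
        by (intro nn_integral_eq_integral integrable_measure_pmf_finite fin) (simp add: nonneg)
      also have "\<dots> \<le> ennreal (\<Phi> (length l') s)"
        using \<open>s \<noteq> g\<close> by (intro ennreal_leI drift)
      finally show ?thesis using \<open>g \<notin> set (butlast l')\<close> by (simp add: l)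
    qed
  qed
  also note Suc
  finally show ?case .
qed

lemma stopped_value_trajectory:
  assumes "n > 0"
  shows "stopped_value \<Phi> g (trajectory X n) =
    (if \<exists>t. 1 \<le> t \<and> t \<le> n \<and> X t = g then \<Phi> (LEAST t. 1 \<le> t \<and> X t = g) g else \<Phi> n (X n))"
  using assms
proof (induction n rule: nat_induct_non_zero)
  case 1
  have "(LEAST t. 1 \<le> t \<and> X t = g) = 1" if "X 1 = g"
    using that by (intro Least_equality) auto
  then show ?case by (auto simp: trajectory_Suc trajectory_0 le_Suc_eq)
next
  case (Suc n)
  have bl: "set (butlast (trajectory X n)) = X ` {1..n}"
  proof -
    have "[0..<Suc n] = 0 # [1..<Suc n]" by (simp add: upt_conv_Cons)
    then have "trajectory X n = map X (rev [1..<Suc n]) @ [X 0]"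
      by (simp add: trajectory_def)
    then show ?thesis by (simp only: butlast_snoc) auto
  qed
  have least: "(LEAST t. 1 \<le> t \<and> X t = g) = Suc n" if "\<not> (\<exists>t. 1 \<le> t \<and> t \<le> n \<and> X t = g)" "X (Suc n) = g"
  proof (rule Least_equality)
    show "Suc n \<le> t" if "1 \<le> t \<and> X t = g" for t
      using that \<open>\<not> (\<exists>t. 1 \<le> t \<and> t \<le> n \<and> X t = g)\<close> not_less_eq_eq by blast
  qed (use that in simp)
  show ?case
  proof (cases "\<exists>t. 1 \<le> t \<and> t \<le> n \<and> X t = g")
    case True
    then have "g \<in> set (butlast (trajectory X n))" by (auto simp: bl)
    moreover have "\<exists>t. 1 \<le> t \<and> t \<le> Suc n \<and> X t = g" using True le_SucI by blast
    ultimately show ?thesis using Suc True by (simp add: trajectory_Suc)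
  next
    case False
    then have "g \<notin> set (butlast (trajectory X n))" by (auto simp: bl)
    then have "stopped_value \<Phi> g (trajectory X (Suc n)) = \<Phi> (Suc n) (X (Suc n))"
      by (simp add: trajectory_Suc length_trajectory)
    moreover have "(\<exists>t. 1 \<le> t \<and> t \<le> Suc n \<and> X t = g) \<longleftrightarrow> X (Suc n) = g"
      using False le_Suc_eq by auto
    ultimately show ?thesis using least[OF False] by simp
  qed
qed

text \<open>With \<open>\<Phi> t s = (e * t + F s powr (1 / q)) powr q\<close> the stopped values form a supermartingale, and at the
  relaxation time their value is at least \<open>(e * \<tau>) powr q\<close>. The expected stopped values are bounded,
  and Fatou's lemma carries the bound over to the moment of \<open>\<tau>\<close>; on \<open>\<tau> = \<infinity>\<close> the stopped values
  tend to infinity.\<close>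

theorem (in exclusion_voter_process) relaxation_moment_if_drift:
  fixes F :: "config_class \<Rightarrow> real" and c q :: real
  assumes pos: "\<P>(\<omega> in M. \<xi> 0 \<omega> = S) > 0"
    and fin: "\<And>S. finite (set_pmf (transition \<beta> p S))"
    and F: "\<And>S. 0 \<le> F S" "\<And>S. S \<noteq> ground_state \<Longrightarrow> 0 < F S"
    and q: "1 \<le> q" and c: "0 < c"
    and drift: "\<And>S. S \<noteq> ground_state \<Longrightarrow>
      measure_pmf.expectation (transition \<beta> p S) F \<le> F S - c * F S powr (1 - 1 / q)"
  shows "cond_nn_expectation M (\<lambda>\<omega>. enat_powr (relaxation_time (\<lambda>t. \<xi> t \<omega>)) q) (\<lambda>\<omega>. \<xi> 0 \<omega> = S) < \<infinity>"
proof -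
  define N where "N = uniform_measure M {\<omega>\<in>space M. \<xi> 0 \<omega> = S}"
  define e where "e = c / q"
  have e: "0 < e" "q * e \<le> c" using c q by (auto simp: e_def)
  define \<Phi> where "\<Phi> t s = (e * real t + F s powr (1 / q)) powr q" for t s
  define Y where "Y n \<omega> = ennreal (stopped_value \<Phi> ground_state (trajectory (\<lambda>t. \<xi> t \<omega>) (Suc n)))" for n \<omega>
  have TN: "(\<lambda>\<omega>. trajectory (\<lambda>t. \<xi> t \<omega>) n) \<in> measurable N (count_space UNIV)" for n
    using trajectory_measurable[of n] by (simp add: N_def)
  have Ym: "Y n \<in> borel_measurable N" for n
    unfolding Y_def by (rule measurable_compose[OF TN]) simp
  have bound: "(\<integral>\<^sup>+\<omega>. Y n \<omega> \<partial>N) \<le> (\<integral>\<^sup>+s. \<Phi> 1 s \<partial>transition \<beta> p S)" for n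
  proof -
    have "(\<integral>\<^sup>+\<omega>. Y n \<omega> \<partial>N) =
        (\<integral>\<^sup>+l. stopped_value \<Phi> ground_state l \<partial>distr N (count_space UNIV) (\<lambda>\<omega>. trajectory (\<lambda>t. \<xi> t \<omega>) (Suc n)))"
      unfolding Y_def by (rule nn_integral_distr[symmetric, OF TN]) simp
    also have "\<dots> = (\<integral>\<^sup>+l. stopped_value \<Phi> ground_state l \<partial>history (transition \<beta> p) S (Suc n))"
      unfolding N_def distr_trajectory[OF pos] ..
    also have "\<dots> \<le> (\<integral>\<^sup>+s. \<Phi> 1 s \<partial>transition \<beta> p S)"
    proof (rule stopped_value_supermartingale[OF fin])
      show "measure_pmf.expectation (transition \<beta> p s) (\<Phi> (Suc t)) \<le> \<Phi> t s" if "s \<noteq> ground_state" for t s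
        using drift_with_clock[OF fin F(1) F(2)[OF that] q drift[OF that], of e "real t"] e
        by (simp add: \<Phi>_def[abs_def] add.commute)
    qed (simp add: \<Phi>_def)
    finally show ?thesis .
  qed
  have fin_start: "(\<integral>\<^sup>+s. \<Phi> 1 s \<partial>transition \<beta> p S) < \<infinity>"
    by (subst nn_integral_eq_integral[OF integrable_measure_pmf_finite[OF fin]]) (simp_all add: \<Phi>_def)
  have low: "ennreal (e powr q) * enat_powr (relaxation_time (\<lambda>t. \<xi> t \<omega>)) q \<le> liminf (\<lambda>n. Y n \<omega>)" for \<omega>
  proof (cases "\<exists>t\<ge>1. \<xi> t \<omega> = ground_state")
    case True
    define T where "T = (LEAST t. 1 \<le> t \<and> \<xi> t \<omega> = ground_state)"
    have T: "1 \<le> T" "\<xi> T \<omega> = ground_state"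
      using True LeastI_ex[of "\<lambda>t. 1 \<le> t \<and> \<xi> t \<omega> = ground_state"] by (auto simp: T_def)
    have "ennreal ((e * real T) powr q) \<le> Y n \<omega>" if "n \<ge> T" for n
    proof -
      have "Y n \<omega> = ennreal (\<Phi> T ground_state)"
        using T that unfolding Y_def by (subst stopped_value_trajectory) (auto simp: T_def intro: le_SucI)
      then show ?thesis using e q unfolding \<Phi>_def
        by (auto intro!: ennreal_leI powr_mono2)
    qed
    then have "ennreal ((e * real T) powr q) \<le> liminf (\<lambda>n. Y n \<omega>)"
      by (intro Liminf_bounded) (auto simp: eventually_sequentially)
    moreover have "relaxation_time (\<lambda>t. \<xi> t \<omega>) = enat T"
      using True by (simp add: relaxation_time_def T_def)
    ultimately show ?thesis
      using e by (simp add: enat_powr_def powr_mult ennreal_mult[symmetric])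
  next
    case False
    have "ennreal (e powr q * real n powr q) \<le> Y n \<omega>" for n
    proof -
      have "Y n \<omega> = ennreal (\<Phi> (Suc n) (\<xi> (Suc n) \<omega>))"
        using False unfolding Y_def by (subst stopped_value_trajectory) auto
      moreover have "(e * real n) powr q \<le> \<Phi> (Suc n) (\<xi> (Suc n) \<omega>)"
        using e q unfolding \<Phi>_def by (intro powr_mono2) (auto simp: algebra_simps add_increasing2)
      ultimately show ?thesis
        using e by (simp add: powr_mult ennreal_leI)
    qed
    moreover have "filterlim (\<lambda>n. e powr q * real n powr q) at_top sequentially"
      using e q by real_asymp
    then have "(\<lambda>n. ennreal (e powr q * real n powr q)) \<longlonglongrightarrow> \<infinity>"
      by (simp add: ennreal_tendsto_top_eq_at_top)
    ultimately have "(\<lambda>n. Y n \<omega>) \<longlonglongrightarrow> \<infinity>"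
      using tendsto_sandwich[of "\<lambda>n. ennreal (e powr q * real n powr q)" "\<lambda>n. Y n \<omega>" sequentially "\<lambda>_. \<infinity>" \<infinity>] by simp
    then show ?thesis using lim_imp_Liminf[of sequentially] by fastforce
  qed
  \<comment> \<open>Here the constant multiplies the limit inferior, which is measurable.\<close>
  have low': "enat_powr (relaxation_time (\<lambda>t. \<xi> t \<omega>)) q \<le> ennreal (e powr - q) * liminf (\<lambda>n. Y n \<omega>)" for \<omega>
  proof -
    have "enat_powr (relaxation_time (\<lambda>t. \<xi> t \<omega>)) q
        = ennreal (e powr - q) * (ennreal (e powr q) * enat_powr (relaxation_time (\<lambda>t. \<xi> t \<omega>)) q)"
      using e by (simp add: mult.assoc[symmetric] ennreal_mult[symmetric] powr_add[symmetric])
    also have "\<dots> \<le> ennreal (e powr - q) * liminf (\<lambda>n. Y n \<omega>)"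
      by (rule mult_left_mono[OF low]) simp
    finally show ?thesis .
  qed
  have "(\<integral>\<^sup>+\<omega>. enat_powr (relaxation_time (\<lambda>t. \<xi> t \<omega>)) q \<partial>N)
      \<le> (\<integral>\<^sup>+\<omega>. ennreal (e powr - q) * liminf (\<lambda>n. Y n \<omega>) \<partial>N)"
    by (intro nn_integral_mono low')
  also have "\<dots> = ennreal (e powr - q) * (\<integral>\<^sup>+\<omega>. liminf (\<lambda>n. Y n \<omega>) \<partial>N)"
    using Ym by (intro nn_integral_cmult) measurable
  also have "(\<integral>\<^sup>+\<omega>. liminf (\<lambda>n. Y n \<omega>) \<partial>N) \<le> liminf (\<lambda>n. \<integral>\<^sup>+\<omega>. Y n \<omega> \<partial>N)"
    by (rule nn_integral_liminf[OF Ym])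
  also have "\<dots> \<le> (\<integral>\<^sup>+s. \<Phi> 1 s \<partial>transition \<beta> p S)"
    using bound by (intro Liminf_le) auto
  also have "ennreal (e powr - q) * \<dots> < \<infinity>"
    using fin_start by (simp add: ennreal_mult_less_top)
  finally show ?thesis
    by (simp add: cond_nn_expectation_def N_def mult_left_mono)
qed

section \<open>Zeros to the left and ones to the right\<close>

definition zeros_upto :: "config \<Rightarrow> int \<Rightarrow> int" where
  "zeros_upto S k = int (card {x. x \<le> k \<and> \<not> label S x})"

definition ones_after :: "config \<Rightarrow> int \<Rightarrow> int" where
  "ones_after S k = int (card {x. k < x \<and> label S x})"

lemma finite_zeros_upto: "finite {x. x \<le> k \<and> \<not> label S x}"
proof (rule finite_subset)
  show "{x. x \<le> k \<and> \<not> label S x} \<subseteq> {x. x < 0 \<and> \<not> label S x} \<union> {0..k}" by auto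
  show "finite ({x. x < 0 \<and> \<not> label S x} \<union> {0..k})" using label[of S] by simp
qed

lemma finite_ones_after: "finite {x. k < x \<and> label S x}"
proof (rule finite_subset)
  show "{x. k < x \<and> label S x} \<subseteq> {x. x > 0 \<and> label S x} \<union> {k..0}" by auto
  show "finite ({x. x > 0 \<and> label S x} \<union> {k..0})" using label[of S] by simp
qed

lemma zeros_upto_nonneg [simp]: "0 \<le> zeros_upto S k"
  and ones_after_nonneg [simp]: "0 \<le> ones_after S k"
  by (simp_all add: zeros_upto_def ones_after_def)

lemma zeros_upto_step: "zeros_upto S (k + 1) = zeros_upto S k + of_bool (\<not> label S (k + 1))"
proof -
  have "{x. x \<le> k + 1 \<and> \<not> label S x} =
      (if label S (k + 1) then {x. x \<le> k \<and> \<not> label S x} else insert (k + 1) {x. x \<le> k \<and> \<not> label S x})"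
    by (auto simp: zle_add1_eq_le order_le_less)
  then show ?thesis using finite_zeros_upto[of k S] by (simp add: zeros_upto_def)
qed

lemma ones_after_step: "ones_after S k = ones_after S (k + 1) + of_bool (label S (k + 1))"
proof -
  have "k < x \<longleftrightarrow> x = k + 1 \<or> k + 1 < x" for x by auto
  then have "{x. k < x \<and> label S x} =
      (if label S (k + 1) then insert (k + 1) {x. k + 1 < x \<and> label S x} else {x. k + 1 < x \<and> label S x})"
    by auto
  then show ?thesis using finite_ones_after[of "k + 1" S] by (simp add: ones_after_def)
qed

lemma zeros_upto_mono: "j \<le> k \<Longrightarrow> zeros_upto S j \<le> zeros_upto S k"
  unfolding zeros_upto_def by (intro zle_int[THEN iffD2] card_mono finite_zeros_upto) auto

lemma ones_after_antimono: "j \<le> k \<Longrightarrow> ones_after S k \<le> ones_after S j"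
  unfolding ones_after_def by (intro zle_int[THEN iffD2] card_mono finite_ones_after) auto

lemma zeros_upto_pos: "x \<le> k \<Longrightarrow> \<not> label S x \<Longrightarrow> 0 < zeros_upto S k"
  unfolding zeros_upto_def using finite_zeros_upto[of k S] by (auto simp: card_gt_0_iff)

lemma ones_after_pos: "k < x \<Longrightarrow> label S x \<Longrightarrow> 0 < ones_after S k"
  unfolding ones_after_def using finite_ones_after[of k S] by (auto simp: card_gt_0_iff)

text \<open>Identities between counting functions are checked on their increments; this lemma turns equal
  increments into equality up to a constant, and the behaviour far out on the line fixes the constant.\<close>

lemma int_shift_invariant:
  fixes f :: "int \<Rightarrow> 'b"
  assumes "\<And>k. f (k + 1) = f k"
  shows "f j = f k"
proof -
  have "f i = f 0" for i
  proof (induction i rule: int_induct[where k = 0])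
    case (step2 i)
    then show ?case using assms[of "i - 1"] by simp
  qed (simp_all add: assms)
  then show ?thesis by metis
qed

text \<open>The position of the step of the unique ground configuration that arises from \<open>S\<close> by exclusion moves
  alone: the level at which zeros to the left and ones to the right balance.\<close>

definition charge :: "config \<Rightarrow> int" where
  "charge S = ones_after S 0 - zeros_upto S 0"

lemma charge_eq: "zeros_upto S k - ones_after S k = k - charge S"
proof -
  have "zeros_upto S k - ones_after S k - k = zeros_upto S 0 - ones_after S 0 - 0"
  proof (rule int_shift_invariant[of "\<lambda>k. zeros_upto S k - ones_after S k - k"])
    show "zeros_upto S (k + 1) - ones_after S (k + 1) - (k + 1) = zeros_upto S k - ones_after S k - k" for k
      using zeros_upto_step[of S k] ones_after_step[of S k] by auto
  qed
  then show ?thesis by (simp add: charge_def)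
qed

text \<open>A window outside which \<open>S\<close> agrees with the ground configuration. Sums over all levels become sums
  over one window that is common to a configuration and its successors.\<close>

definition confined :: "config \<Rightarrow> int \<Rightarrow> bool" where
  "confined S n \<longleftrightarrow> (\<forall>x\<le>-n. label S x) \<and> (\<forall>x\<ge>n. \<not> label S x)"

lemma confined_exists: "\<exists>n\<ge>m. confined S n"
proof -
  have fin: "finite ({x. x < 0 \<and> \<not> label S x} \<union> {x. x > 0 \<and> label S x})"
    using label[of S] by simp
  obtain b where b: "\<And>x. x \<in> {x. x < 0 \<and> \<not> label S x} \<union> {x. x > 0 \<and> label S x} \<Longrightarrow> \<bar>x\<bar> \<le> b"
    using finite_imageI[OF fin, of abs] by (meson bdd_above_finite bdd_above.E image_eqI)
  have "confined S (max m (max 1 (b + 1)))"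
    unfolding confined_def using b by (force simp: max_def split: if_splits)
  then show ?thesis using max.cobounded1 by blast
qed

lemma zeros_upto_confined: "confined S n \<Longrightarrow> k \<le> -n \<Longrightarrow> zeros_upto S k = 0"
  by (force simp: zeros_upto_def confined_def card_eq_0_iff)

lemma ones_after_confined: "confined S n \<Longrightarrow> n \<le> k \<Longrightarrow> ones_after S k = 0"
  by (force simp: ones_after_def confined_def card_eq_0_iff)

lemma zeros_upto_unique:
  assumes "\<And>k. G (k + 1) = G k + of_bool (\<not> label S (k + 1))" and "\<And>k. k \<le> m \<Longrightarrow> G k = 0"
  shows "G k = zeros_upto S k"
proof -
  obtain n where n: "n \<ge> -m" "confined S n" using confined_exists by blast
  have "G k - zeros_upto S k = G (-n) - zeros_upto S (-n)"
    by (rule int_shift_invariant[of "\<lambda>k. G k - zeros_upto S k"]) (simp add: assms(1) zeros_upto_step)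
  then show ?thesis using n assms(2)[of "-n"] zeros_upto_confined[of S n "-n"] by simp
qed

lemma ones_after_unique:
  assumes "\<And>k. G k = G (k + 1) + of_bool (label S (k + 1))" and "\<And>k. m \<le> k \<Longrightarrow> G k = 0"
  shows "G k = ones_after S k"
proof -
  obtain n where n: "n \<ge> m" "confined S n" using confined_exists by blast
  have "G k - ones_after S k = G n - ones_after S n"
  proof (rule int_shift_invariant[of "\<lambda>k. G k - ones_after S k"])
    show "G (k + 1) - ones_after S (k + 1) = G k - ones_after S k" for k
      using assms(1)[of k] ones_after_step[of S k] by simp
  qed
  then show ?thesis using n assms(2)[of n] ones_after_confined[of S n n] by simp
qed

lemma zeros_upto_set_pair:
  "zeros_upto (set_pair S x a b) k = zeros_upto S k
    + (if x \<le> k then of_bool (label S x) - of_bool a else 0)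
    + (if x + 1 \<le> k then of_bool (label S (x + 1)) - of_bool b else 0)"
proof -
  obtain n where n: "n \<ge> 1 - x" "confined S n" using confined_exists by blast
  show ?thesis
  proof (rule zeros_upto_unique[symmetric, where m="-n"], goal_cases)
    case (1 k)
    consider "k + 1 < x" | "x = k + 1" | "x = k" | "x < k" by linarith
    then show ?case
      by cases (auto simp: set_pair.rep_eq zeros_upto_step)
  next
    case (2 k)
    then show ?case using n zeros_upto_confined[of S n k] by auto
  qed
qed

lemma ones_after_set_pair:
  "ones_after (set_pair S x a b) k = ones_after S k
    + (if k < x then of_bool a - of_bool (label S x) else 0)
    + (if k < x + 1 then of_bool b - of_bool (label S (x + 1)) else 0)"
proof -
  obtain n where n: "n \<ge> x + 1" "confined S n" using confined_exists by blast
  show ?thesis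
  proof (rule ones_after_unique[symmetric, where m=n], goal_cases)
    case (1 k)
    consider "k + 1 < x" | "x = k + 1" | "x = k" | "x < k" by linarith
    then show ?case
      by cases (auto simp: set_pair.rep_eq ones_after_step[of S k])
  next
    case (2 k)
    then show ?case using n ones_after_confined[of S n k] by auto
  qed
qed

lemma confined_set_pair: "confined S n \<Longrightarrow> -n < x \<Longrightarrow> x + 1 < n \<Longrightarrow> confined (set_pair S x a b) n"
  by (auto simp: confined_def set_pair.rep_eq)

section \<open>The number of inversions and their total span\<close>

text \<open>The levels at which \<open>S\<close> is disordered; they are the levels with a nonzero summand in the two
  statistics below.\<close>

definition overlap :: "config \<Rightarrow> int set" where
  "overlap S = {k. 0 < zeros_upto S k \<and> 0 < ones_after S k}"

text \<open>The number of pairs \<open>x < y\<close> with a zero at \<open>x\<close> and a one at \<open>y\<close>. These pairs are the cells of a Young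
  diagram whose boundary is the configuration, and \<open>min (zeros_upto S k) (ones_after S k)\<close> is the length of
  one of its diagonals. In this form a flip changes each summand by at most one, which reduces the
  voter drift to a pointwise identity.\<close>

definition inversions :: "config \<Rightarrow> int" where
  "inversions S = (\<Sum>k\<in>overlap S. min (zeros_upto S k) (ones_after S k))"

text \<open>The sum of \<open>y - x\<close> over all inversions \<open>x < y\<close>, that is the sum of all hook lengths of the Young diagram:
  level \<open>k\<close> counts the inversions that have their zero at or before \<open>k\<close> and their one after \<open>k\<close>.\<close>

definition inversion_span :: "config \<Rightarrow> int" where
  "inversion_span S = (\<Sum>k\<in>overlap S. zeros_upto S k * ones_after S k)"

lemma overlap_confined:
  assumes "confined S n" shows "overlap S \<subseteq> {-n..n}"
proof
  fix k assume "k \<in> overlap S"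
  then show "k \<in> {-n..n}"
    using zeros_upto_confined[OF assms, of k] ones_after_confined[OF assms, of k]
    by (auto simp: overlap_def not_le[symmetric] intro: ccontr)
qed

lemma finite_overlap: "finite (overlap S)"
  using confined_exists[of 0 S] overlap_confined finite_subset finite_atLeastAtMost_int by metis

lemma inversions_confined:
  assumes "confined S n"
  shows "inversions S = (\<Sum>k=-n..n. min (zeros_upto S k) (ones_after S k))"
  unfolding inversions_def
proof (rule sum.mono_neutral_left)
  show "\<forall>i\<in>{-n..n} - overlap S. min (zeros_upto S i) (ones_after S i) = 0"
    using zeros_upto_nonneg[of S] ones_after_nonneg[of S] by (fastforce simp: overlap_def min_def not_less intro: antisym)
qed (use overlap_confined[OF assms] in auto)

lemma inversion_span_confined:
  assumes "confined S n"
  shows "inversion_span S = (\<Sum>k=-n..n. zeros_upto S k * ones_after S k)"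
  unfolding inversion_span_def
proof (rule sum.mono_neutral_left)
  show "\<forall>i\<in>{-n..n} - overlap S. zeros_upto S i * ones_after S i = 0"
    using zeros_upto_nonneg[of S] ones_after_nonneg[of S] by (fastforce simp: overlap_def not_less intro: antisym)
qed (use overlap_confined[OF assms] in auto)

abbreviation height :: "config \<Rightarrow> int \<Rightarrow> int" where
  "height S k \<equiv> zeros_upto S k + ones_after S k"

text \<open>Away from the chosen pair, the two outcomes move one of the two counts at level \<open>k\<close> up and down by one.
  The second difference of \<open>min\<close> is nonzero only on the diagonal, and the two counts are equal
  exactly at the level \<open>charge S\<close>. This contributes \<open>-1\<close>; the pair itself contributes \<open>1\<close> or \<open>-1\<close>.\<close>

lemma inversions_voter:
  assumes x: "x \<in> unlike_pairs S"
  shows "inversions (set_pair S x True True) + inversions (set_pair S x False False)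
    = 2 * inversions S - 2 * of_bool (\<not> label S x)"
proof -
  obtain n where n: "n \<ge> max \<bar>charge S\<bar> (\<bar>x\<bar> + 2)" "confined S n" using confined_exists by blast
  let ?m = "\<lambda>S k. min (zeros_upto S k) (ones_after S k)"
  have "?m (set_pair S x True True) k + ?m (set_pair S x False False) k - 2 * ?m S k
      = (if k = x then (if label S x then 1 else -1) else 0) - (if k = charge S then 1 else 0)" for k
  proof -
    have "k = charge S \<longleftrightarrow> zeros_upto S k = ones_after S k"
      using charge_eq[of S k] by auto
    then show ?thesis
    using x by (cases k x rule: linorder_cases)
       (auto simp: zeros_upto_set_pair ones_after_set_pair unlike_pairs_def min_def)
  qed
  then have "(\<Sum>k=-n..n. ?m (set_pair S x True True) k + ?m (set_pair S x False False) k - 2 * ?m S k)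
      = (\<Sum>k=-n..n. (if k = x then (if label S x then 1 else -1) else 0) - (if k = charge S then 1 else 0))"
    by simp
  also have "\<dots> = - 2 * of_bool (\<not> label S x)"
    using n by (simp add: sum_subtractf sum.delta) auto
  finally have eq: "(\<Sum>k=-n..n. ?m (set_pair S x True True) k + ?m (set_pair S x False False) k - 2 * ?m S k)
    = - 2 * of_bool (\<not> label S x)" .
  have "confined (set_pair S x b b) n" for b
    using n by (intro confined_set_pair) auto
  then show ?thesis
    using eq n by (simp add: inversions_confined[of _ n] sum.distrib sum_subtractf sum_distrib_left)
qed

text \<open>The product of the two counts is linear in each of them, so only the level of the chosen pair, where
  both counts change, contributes.\<close>

lemma inversion_span_voter:
  assumes x: "x \<in> unlike_pairs S"
  shows "inversion_span (set_pair S x True True) + inversion_span (set_pair S x False False)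
    = 2 * inversion_span S + (if label S x then height S x else - height S x)"
proof -
  obtain n where n: "n \<ge> \<bar>x\<bar> + 2" "confined S n" using confined_exists by blast
  let ?m = "\<lambda>S k. zeros_upto S k * ones_after S k"
  have "?m (set_pair S x True True) k + ?m (set_pair S x False False) k - 2 * ?m S k
      = (if k = x then (if label S x then height S x else - height S x) else 0)" for k
    using x by (cases k x rule: linorder_cases)
       (auto simp: zeros_upto_set_pair ones_after_set_pair unlike_pairs_def algebra_simps)
  then have "(\<Sum>k=-n..n. ?m (set_pair S x True True) k + ?m (set_pair S x False False) k - 2 * ?m S k)
      = (\<Sum>k=-n..n. (if k = x then (if label S x then height S x else - height S x) else 0))"
    by simp
  also have "\<dots> = (if label S x then height S x else - height S x)"
    using n by (subst sum.delta) auto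
  finally show ?thesis
    using n by (simp add: inversion_span_confined[of _ n] confined_set_pair sum.distrib sum_subtractf sum_distrib_left)
qed

lemma inversion_span_exclusion:
  assumes x: "x \<in> unlike_pairs S"
  shows "inversion_span (set_pair S x (\<not> label S x) (label S x))
    = inversion_span S + 1 + (if label S x then height S x else - height S x)"
proof -
  obtain n where n: "n \<ge> \<bar>x\<bar> + 2" "confined S n" using confined_exists by blast
  let ?S = "set_pair S x (\<not> label S x) (label S x)"
  let ?m = "\<lambda>S k. zeros_upto S k * ones_after S k"
  have "?m ?S k - ?m S k = (if k = x then 1 + (if label S x then height S x else - height S x) else 0)" for k
    using x by (cases k x rule: linorder_cases)
       (auto simp: zeros_upto_set_pair ones_after_set_pair unlike_pairs_def algebra_simps)
  then have "(\<Sum>k=-n..n. ?m ?S k - ?m S k)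
      = (\<Sum>k=-n..n. (if k = x then 1 + (if label S x then height S x else - height S x) else 0))"
    by simp
  also have "\<dots> = 1 + (if label S x then height S x else - height S x)"
    using n by (subst sum.delta) auto
  finally show ?thesis
    using n by (simp add: inversion_span_confined[of _ n] confined_set_pair sum_subtractf)
qed

section \<open>Ascents, descents and the height\<close>

text \<open>The unlike pairs labelled \<open>01\<close>; the pairs labelled \<open>10\<close> are the descents below. In terms of the height they
  are its local maxima and minima.\<close>

definition ascents :: "config \<Rightarrow> int set" where
  "ascents S = {x. \<not> label S x \<and> label S (x + 1)}"

definition descents :: "config \<Rightarrow> int set" where
  "descents S = {x. label S x \<and> \<not> label S (x + 1)}"

lemma unlike_pairs_split: "unlike_pairs S = ascents S \<union> descents S" "ascents S \<inter> descents S = {}"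
  by (auto simp: unlike_pairs_def ascents_def descents_def)

lemma finite_ascents [simp]: "finite (ascents S)" and finite_descents [simp]: "finite (descents S)"
  using finite_unlike_pairs[of S] by (simp_all add: unlike_pairs_split)

lemma int_sum_telescope:
  fixes f :: "int \<Rightarrow> 'b::ab_group_add"
  assumes "a \<le> b"
  shows "(\<Sum>k=a..b. f k - f (k + 1)) = f a - f (b + 1)"
  using assms
proof (induction b rule: int_ge_induct)
  case (step b)
  have "{a..b + 1} = insert (b + 1) {a..b}" using step by auto
  then show ?case using step by simp
qed simp

text \<open>Along the line descents count with weight \<open>1\<close> and ascents with weight \<open>-1\<close>. If the weighted summand is
  the increment of \<open>T\<close>, only the values of \<open>T\<close> far out on both sides remain.\<close>

lemma sum_descents_minus_ascents:
  fixes g T :: "int \<Rightarrow> int"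
  assumes T: "\<And>k. g k * (of_bool (label S k) - of_bool (label S (k + 1))) = T k - T (k + 1)"
    and left: "\<And>k. k \<le> -m \<Longrightarrow> T k = l" and right: "\<And>k. m \<le> k \<Longrightarrow> T k = r"
  shows "sum g (descents S) - sum g (ascents S) = l - r"
proof -
  obtain n where n: "n \<ge> max 0 m" "confined S n" using confined_exists by blast
  have "x \<in> {-n..n}" if "label S x \<noteq> label S (x + 1)" for x
  proof (rule ccontr)
    assume "x \<notin> {-n..n}"
    then have "x + 1 \<le> -n \<or> n \<le> x" by auto
    then show False using that n by (auto simp: confined_def)
  qed
  then have "ascents S \<subseteq> {-n..n}" "descents S \<subseteq> {-n..n}"
    by (auto simp: ascents_def descents_def)
  then have "sum g (descents S) - sum g (ascents S)
      = (\<Sum>k=-n..n. if k \<in> descents S then g k else 0) - (\<Sum>k=-n..n. if k \<in> ascents S then g k else 0)"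
    by (simp add: sum.If_cases Int_absorb1)
  also have "\<dots> = (\<Sum>k=-n..n. g k * (of_bool (label S k) - of_bool (label S (k + 1))))"
    unfolding sum_subtractf[symmetric]
    by (intro sum.cong) (auto simp: ascents_def descents_def)
  also have "\<dots> = T (-n) - T (n + 1)"
    using n by (simp add: T int_sum_telescope)
  finally show ?thesis using n left right by simp
qed

lemma card_descents: "card (descents S) = Suc (card (ascents S))"
proof -
  obtain n where n: "confined S n" using confined_exists by blast
  have "sum (\<lambda>_. 1) (descents S) - sum (\<lambda>_. 1) (ascents S) = 1 - (0::int)"
    by (rule sum_descents_minus_ascents[where m=n and T="\<lambda>k. of_bool (label S k)"])
       (use n in \<open>auto simp: confined_def\<close>)
  then show ?thesis by simp
qed

text \<open>This identity makes the inversion span a martingale under voter moves, and it lets the biased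
  exclusion moves win. The height grows by one at each zero and falls by one at each one, so the alternating
  sum of its local extrema telescopes.\<close>

lemma sum_height_descents: "sum (height S) (descents S) = sum (height S) (ascents S)"
proof -
  obtain n where n: "confined S n" using confined_exists by blast
  have "sum (height S) (descents S) - sum (height S) (ascents S) = 0 - 0"
  proof (rule sum_descents_minus_ascents[where m=n and T="\<lambda>k. height S k * of_bool (label S k) - ones_after S k"], goal_cases)
    case (1 k)
    show ?case using zeros_upto_step[of S k] ones_after_step[of S k] by (auto simp: algebra_simps)
  next
    case (2 k)
    then show ?case using n zeros_upto_confined[OF n, of k] by (auto simp: confined_def)
  next
    case (3 k)
    then show ?case using n ones_after_confined[OF n, of k] by (auto simp: confined_def)
  qed
  then show ?thesis by simp
qed

text \<open>Each ascent up to \<open>x\<close> provides a zero on the left, and each ascent after \<open>x\<close> provides a one on the right.\<close>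

lemma card_ascents_le_height:
  assumes x: "x \<in> ascents S"
  shows "int (card (ascents S)) \<le> height S x"
proof -
  have "ascents S = {y \<in> ascents S. y \<le> x} \<union> {y \<in> ascents S. x < y}" by auto
  then have "card (ascents S) \<le> card {y \<in> ascents S. y \<le> x} + card {y \<in> ascents S. x < y}"
    using card_Un_le by metis
  moreover have "card {y \<in> ascents S. y \<le> x} \<le> card {y. y \<le> x \<and> \<not> label S y}"
    by (intro card_mono finite_zeros_upto) (auto simp: ascents_def)
  moreover have "card {y \<in> ascents S. x < y} \<le> card {y. x < y \<and> label S y}"
    by (intro card_inj_on_le[where f="\<lambda>y. y + 1"] finite_ones_after) (auto simp: ascents_def)
  ultimately show ?thesis by (simp add: zeros_upto_def ones_after_def)
qed

lemma card_ascents_square: "int (card (ascents S)) ^ 2 \<le> sum (height S) (ascents S)"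
  using sum_bounded_below[of "ascents S" "int (card (ascents S))" "height S"] card_ascents_le_height
  by (simp add: power2_eq_square)

text \<open>The first zero is preceded by a one, and the last one is followed by a zero.\<close>

lemma extreme_descents:
  obtains a b where "a \<in> descents S" "b \<in> descents S" "zeros_upto S a = 0" "ones_after S b = 0"
proof -
  obtain n where n: "n \<ge> 0" "confined S n" using confined_exists by blast
  let ?A = "{x\<in>{-n..n}. \<not> label S x}" and ?B = "{x\<in>{-n..n}. label S x}"
  define a b where "a = Min ?A" and "b = Max ?B"
  have "n \<in> ?A" "-n \<in> ?B" using n by (auto simp: confined_def)
  then have "?A \<noteq> {}" "?B \<noteq> {}" by blast+
  moreover have "finite ?A" "finite ?B" by (rule finite_subset[of _ "{-n..n}"]; auto)+
  ultimately have a: "a \<in> ?A" "\<And>x. x \<in> ?A \<Longrightarrow> a \<le> x" and b: "b \<in> ?B" "\<And>x. x \<in> ?B \<Longrightarrow> x \<le> b"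
    unfolding a_def b_def by (auto simp del: mem_Collect_eq intro: Min_in Max_in)
  \<comment> \<open>Everything before the first zero and after the last one is as in the ground configuration.\<close>
  have left: "label S x" if "x < a" for x
  proof (rule ccontr)
    assume "\<not> label S x"
    then have "-n < x" using n by (auto simp: confined_def not_le[symmetric])
    then have "x \<in> ?A" using \<open>\<not> label S x\<close> that a(1) by auto
    then show False using a(2) that by fastforce
  qed
  have right: "\<not> label S x" if "b < x" for x
  proof
    assume "label S x"
    then have "x < n" using n by (auto simp: confined_def not_le[symmetric])
    then have "x \<in> ?B" using \<open>label S x\<close> that b(1) by auto
    then show False using b(2) that by fastforce
  qed
  show ?thesis
  proof (rule that[of "a - 1" b])
    show "a - 1 \<in> descents S" using left a by (simp add: descents_def)
    show "b \<in> descents S" using right b by (simp add: descents_def)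
    have "{x. x \<le> a - 1 \<and> \<not> label S x} = {}" using left by auto
    then show "zeros_upto S (a - 1) = 0" by (simp only: zeros_upto_def) simp
    have "{x. b < x \<and> label S x} = {}" using right by auto
    then show "ones_after S b = 0" by (simp only: ones_after_def) simp
  qed
qed

text \<open>Between the extreme descents \<open>a\<close> and \<open>b\<close> there are \<open>L\<close> sites, so at most \<open>L\<close> levels contribute to the span,
  each of them at most \<open>L * L\<close>. On the other hand the heights at \<open>a\<close> and \<open>b\<close> add up to \<open>L\<close>.\<close>

lemma inversion_span_le_cube: "inversion_span S \<le> sum (height S) (ascents S) ^ 3"
proof -
  obtain a b where ab: "a \<in> descents S" "b \<in> descents S" "zeros_upto S a = 0" "ones_after S b = 0"
    by (rule extreme_descents)
  define L where "L = ones_after S a + zeros_upto S b"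
  have L0: "0 \<le> L" by (simp add: L_def)
  have ba: "b - a = L" using charge_eq[of S a] charge_eq[of S b] ab by (simp add: L_def)
  have "L \<le> sum (height S) (descents S)"
  proof (cases "a = b")
    case True
    then show ?thesis using ab ba by (simp add: sum_nonneg)
  next
    case False
    have "sum (height S) {a, b} \<le> sum (height S) (descents S)"
      using ab by (intro sum_mono2) auto
    then show ?thesis using False ab by (simp add: L_def)
  qed
  then have LH: "L \<le> sum (height S) (ascents S)" by (simp add: sum_height_descents)
  have ov: "a < k \<and> k < b" if "k \<in> overlap S" for k
    using that zeros_upto_mono[of k a S] ones_after_antimono[of b k S] ab
    by (force simp: overlap_def not_less[symmetric])
  have "inversion_span S \<le> (\<Sum>k\<in>overlap S. L * L)"
    unfolding inversion_span_def
  proof (rule sum_mono)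
    fix k assume "k \<in> overlap S"
    then have "a \<le> k" "k \<le> b" using ov by force+
    then have "zeros_upto S k \<le> L" "ones_after S k \<le> L"
      using zeros_upto_mono[of k b S] ones_after_antimono[of a k S]
      by (simp_all add: L_def add_increasing add_increasing2)
    then show "zeros_upto S k * ones_after S k \<le> L * L" using L0 by (intro mult_mono) auto
  qed
  also have "\<dots> = int (card (overlap S)) * (L * L)" by simp
  also have "\<dots> \<le> L * (L * L)"
  proof (rule mult_right_mono)
    have "card (overlap S) \<le> card {a..<b}" using ov by (intro card_mono) force+
    then show "int (card (overlap S)) \<le> L" using ba L0 by simp
  qed simp
  also have "\<dots> = L ^ 3" by (simp add: power3_eq_cube)
  also have "\<dots> \<le> sum (height S) (ascents S) ^ 3" using LH L0 by (rule power_mono)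
  finally show ?thesis .
qed

text \<open>The left hand side is at most \<open>sqrt H\<close> because the span is at most \<open>H ^ 3\<close>. Since also
  \<open>N \<le> sqrt H\<close>, dividing \<open>H\<close> by the number of unlike pairs costs at most a factor \<open>3 * sqrt H\<close>.
  The exponent \<open>1 / 6\<close> is the one that yields the moment \<open>6 / 5 = 1 / (1 - 1 / 6)\<close>.\<close>

lemma inversion_span_le_height_ratio:
  fixes S :: config
  defines "H \<equiv> real_of_int (\<Sum>x\<in>ascents S. height S x)" and "N \<equiv> real (card (ascents S))"
  assumes "0 < N"
  shows "real_of_int (inversion_span S) powr (1 / 6) \<le> 3 * (H / (2 * N + 1))"
proof -
  have N: "1 \<le> N" using assms by (simp add: N_def)
  have "N\<^sup>2 \<le> H" unfolding N_def H_def using card_ascents_square[of S]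
    by (metis of_int_le_iff of_int_of_nat_eq of_int_power)
  then have H: "0 < H" "N \<le> sqrt H" using N by (auto simp: real_le_rsqrt intro: less_le_trans[of 0 "N\<^sup>2"])
  have "real_of_int (inversion_span S) \<le> H ^ 3"
    unfolding H_def using inversion_span_le_cube[of S] by (metis of_int_le_iff of_int_power)
  moreover have "0 \<le> inversion_span S" by (simp add: inversion_span_def sum_nonneg)
  ultimately have "real_of_int (inversion_span S) powr (1 / 6) \<le> (H ^ 3) powr (1 / 6)"
    by (intro powr_mono2) auto
  also have "\<dots> = (H powr 3) powr (1 / 6)"
    using H by simp
  also have "\<dots> = sqrt H"
    using H by (simp only: powr_powr) (simp add: powr_half_sqrt)
  also have "\<dots> \<le> 3 * (H / (2 * N + 1))"
  proof -
    have "sqrt H * (2 * N + 1) \<le> sqrt H * (3 * sqrt H)" using H N by (intro mult_left_mono) auto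
    also have "\<dots> = 3 * H" using H by simp
    finally show ?thesis using N by (simp add: field_simps)
  qed
  finally show ?thesis .
qed

text \<open>Let \<open>m\<close> be the smaller count at level \<open>k\<close>. The larger one is \<open>m + \<bar>k - charge S\<bar>\<close>, so level \<open>k\<close> contributes
  \<open>m * (m + \<bar>k - charge S\<bar>)\<close> to the span. Levels at distance more than \<open>R\<close> from the charge contribute
  at least \<open>R * m\<close>; at the other levels \<open>R * m \<le> m * m + R * R\<close>, and there are at most \<open>3 * R\<close> of them.
  The choice \<open>R = span powr (1 / 3)\<close> balances the two parts.\<close>

lemma inversions_le_span:
  assumes pos: "0 < inversion_span S"
  shows "real_of_int (inversions S) \<le> 4 * real_of_int (inversion_span S) powr (2 / 3)"
proof -
  define R where "R = real_of_int (inversion_span S) powr (1 / 3)"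
  have R: "1 \<le> R" using pos by (simp add: R_def ge_one_powr_ge_zero)
  have R3: "R * R powr 2 = real_of_int (inversion_span S)" and R2: "real_of_int (inversion_span S) powr (2 / 3) = R * R"
    using pos by (simp_all add: R_def powr_powr powr_add[symmetric])
  let ?m = "\<lambda>k. min (zeros_upto S k) (ones_after S k)"
  let ?D = "{k. \<bar>real_of_int (k - charge S)\<bar> \<le> R}"
  have D: "?D = {charge S - \<lfloor>R\<rfloor> .. charge S + \<lfloor>R\<rfloor>}"
  proof -
    have "\<bar>real_of_int j\<bar> \<le> R \<longleftrightarrow> \<bar>j\<bar> \<le> \<lfloor>R\<rfloor>" for j
      unfolding le_floor_iff of_int_abs by (rule refl)
    then have "?D = {k. \<bar>k - charge S\<bar> \<le> \<lfloor>R\<rfloor>}" by (simp only:)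
    also have "\<dots> = {charge S - \<lfloor>R\<rfloor> .. charge S + \<lfloor>R\<rfloor>}"
      by (auto simp del: le_floor_iff)
    finally show ?thesis .
  qed
  have card_D: "real (card ?D) \<le> 3 * R"
  proof -
    have "real (card ?D) = 2 * real_of_int \<lfloor>R\<rfloor> + 1" unfolding D using R by simp
    then show ?thesis using R of_int_floor_le[of R] by linarith
  qed
  have summand: "R * real_of_int (?m k) \<le> real_of_int (zeros_upto S k * ones_after S k) + R * R * of_bool (k \<in> ?D)" for k
  proof -
    define m where "m = real_of_int (?m k)"
    have m: "0 \<le> m" by (simp add: m_def)
    have prod: "real_of_int (zeros_upto S k * ones_after S k) = m * (m + \<bar>real_of_int (k - charge S)\<bar>)"
    proof -
      have "z * w = min z w * (min z w + \<bar>z - w\<bar>)" for z w :: int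
        by (cases "z \<le> w") (auto simp: min_def mult.commute)
      then have "zeros_upto S k * ones_after S k = ?m k * (?m k + \<bar>k - charge S\<bar>)"
        by (simp only: charge_eq[symmetric])
      then show ?thesis
        unfolding m_def by (simp only: of_int_mult of_int_add of_int_abs)
    qed
    show ?thesis
    proof (cases "k \<in> ?D")
      case True
      have "0 \<le> R * m" using R m by simp
      moreover have "2 * (R * m) \<le> R * R + m * m"
        using sum_squares_bound[of R m] by (simp only: power2_eq_square mult.assoc)
      ultimately have "R * m \<le> m * m + R * R" by linarith
      also have "m * m \<le> m * (m + \<bar>real_of_int (k - charge S)\<bar>)" using m by (intro mult_left_mono) auto
      finally show ?thesis using True unfolding prod m_def by simp
    next
      case False
      then have "R \<le> m + \<bar>real_of_int (k - charge S)\<bar>" using m by simp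
      then have "R * m \<le> m * (m + \<bar>real_of_int (k - charge S)\<bar>)" using m
        by (metis mult.commute mult_left_mono)
      then show ?thesis using False unfolding prod m_def by simp
    qed
  qed
  have "R * real_of_int (inversions S) = (\<Sum>k\<in>overlap S. R * real_of_int (?m k))"
    by (simp add: inversions_def sum_distrib_left)
  also have "\<dots> \<le> (\<Sum>k\<in>overlap S. real_of_int (zeros_upto S k * ones_after S k) + R * R * of_bool (k \<in> ?D))"
    by (intro sum_mono summand)
  also have "\<dots> = real_of_int (inversion_span S) + R * R * real (card (overlap S \<inter> ?D))"
    by (simp add: sum.distrib inversion_span_def sum_distrib_left[symmetric] finite_overlap Int_def)
  also have "\<dots> \<le> real_of_int (inversion_span S) + R * R * (3 * R)"
  proof -
    have "card (overlap S \<inter> ?D) \<le> card ?D" unfolding D by (intro card_mono) auto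
    then show ?thesis using card_D R by (intro add_left_mono mult_left_mono) auto
  qed
  also have "\<dots> = R * (4 * (R * R))" using R R3 by (simp add: powr_numeral power2_eq_square)
  finally show ?thesis using R unfolding R2 by simp
qed

section \<open>Statistics of translation classes\<close>

lemma zeros_upto_translate:
  assumes "\<And>x. label S' x = label S (x + j)"
  shows "zeros_upto S' k = zeros_upto S (k + j)"
proof -
  have "bij_betw (\<lambda>x. x + j) {x. x \<le> k \<and> \<not> label S' x} {x. x \<le> k + j \<and> \<not> label S x}"
    by (rule bij_betwI[where g="\<lambda>x. x - j"]) (auto simp: assms)
  then show ?thesis unfolding zeros_upto_def by (simp add: bij_betw_same_card)
qed

lemma ones_after_translate:
  assumes "\<And>x. label S' x = label S (x + j)"
  shows "ones_after S' k = ones_after S (k + j)"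
proof -
  have "bij_betw (\<lambda>x. x + j) {x. k < x \<and> label S' x} {x. k + j < x \<and> label S x}"
    by (rule bij_betwI[where g="\<lambda>x. x - j"]) (auto simp: assms)
  then show ?thesis unfolding ones_after_def by (simp add: bij_betw_same_card)
qed

lemma sum_overlap_translate:
  assumes "translates S S'"
  shows "(\<Sum>k\<in>overlap S. g (zeros_upto S k) (ones_after S k)) = (\<Sum>k\<in>overlap S'. g (zeros_upto S' k) (ones_after S' k))"
proof -
  from assms obtain j where "\<And>x. label S' x = label S (x + j)"
    unfolding translates_def by blast
  note shift = zeros_upto_translate[OF this] ones_after_translate[OF this]
  show ?thesis
    by (rule sum.reindex_bij_witness[where i="\<lambda>k. k + j" and j="\<lambda>k. k - j"]) (auto simp: overlap_def shift)
qed

lift_definition class_inversions :: "config_class \<Rightarrow> real" is "\<lambda>S. real_of_int (inversions S)"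
  unfolding inversions_def by (simp only: sum_overlap_translate)

lift_definition class_span :: "config_class \<Rightarrow> real" is "\<lambda>S. real_of_int (inversion_span S)"
  unfolding inversion_span_def by (simp only: sum_overlap_translate)

text \<open>Without ascents, all sites after a zero are zeros.\<close>

lemma ground_state_if_no_ascents:
  assumes "ascents S = {}"
  shows "class_of S = ground_state"
proof -
  obtain n where n: "n \<ge> 0" "confined S n" using confined_exists by blast
  obtain a where a: "a \<in> descents S" "zeros_upto S a = 0"
    using extreme_descents[of S] by metis
  have left: "label S x" if "x \<le> a" for x
    using zeros_upto_pos[OF that, of S] a by auto
  have right: "\<not> label S x" if "a < x" for x
    using that
  proof (induction x rule: int_gr_induct)
    case base
    then show ?case using a by (simp add: descents_def)
  next
    case (step x)
    then show ?case using assms by (auto simp: ascents_def)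
  qed
  have "translates S ground_config"
    unfolding translates_def ground_config.rep_eq using left right
    by (intro exI[of _ "a + 1"]) (metis add.commute add_le_same_cancel1 linorder_not_less zless_add1_eq zle_add1_eq_le add.assoc)
  then show ?thesis by (simp add: ground_state_def class_of_eq_iff)
qed

lemma height_ascent: "x \<in> ascents S \<Longrightarrow> 1 \<le> zeros_upto S x \<and> 1 \<le> ones_after S x"
  using zeros_upto_pos[of x x S] ones_after_pos[of x "x + 1" S] by (simp add: ascents_def)

lemma inversions_pos: "ascents S \<noteq> {} \<Longrightarrow> 1 \<le> inversions S"
  and inversion_span_pos: "ascents S \<noteq> {} \<Longrightarrow> 1 \<le> inversion_span S"
proof -
  assume "ascents S \<noteq> {}"
  then obtain x where "x \<in> ascents S" by blast
  note x = height_ascent[OF this]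
  then have ov: "{x} \<subseteq> overlap S" by (auto simp: overlap_def)
  have "1 \<le> (\<Sum>k\<in>{x}. min (zeros_upto S k) (ones_after S k))" using x by simp
  also have "\<dots> \<le> inversions S"
    unfolding inversions_def by (intro sum_mono2 finite_overlap ov) auto
  finally show "1 \<le> inversions S" .
  have "1 * 1 \<le> zeros_upto S x * ones_after S x" using x by (intro mult_mono) auto
  then have "1 \<le> (\<Sum>k\<in>{x}. zeros_upto S k * ones_after S k)" by simp
  also have "\<dots> \<le> inversion_span S"
    unfolding inversion_span_def by (intro sum_mono2 finite_overlap ov) auto
  finally show "1 \<le> inversion_span S" .
qed

lemma inversions_nonneg: "0 \<le> inversions S" and inversion_span_nonneg: "0 \<le> inversion_span S"
  by (auto simp: inversions_def inversion_span_def intro!: sum_nonneg)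

section \<open>Expected change in one step\<close>

lemma finite_set_voter_move: "finite (set_pmf (voter_move S x))"
  by (simp add: voter_move_def)

lemma finite_set_exclusion_move: "finite (set_pmf (exclusion_move p S x))"
  by (simp add: exclusion_move_def)

lemma finite_set_config_step: "finite (set_pmf (config_step \<beta> p S))"
  by (auto simp: config_step_def finite_set_voter_move finite_set_exclusion_move
      set_pmf_of_set unlike_pairs_nonempty finite_unlike_pairs)

lemma finite_set_transition: "finite (set_pmf (transition \<beta> p c))"
  by (induction c) (simp add: transition.abs_eq finite_set_config_step)

lemma expectation_config_step:
  fixes g :: "config \<Rightarrow> real" and S :: config
  assumes "0 \<le> \<beta>" "\<beta> \<le> 1" "0 \<le> p" "p \<le> 1"
  defines "v \<equiv> \<lambda>x. (g (set_pair S x True True) + g (set_pair S x False False)) / 2"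
  shows "measure_pmf.expectation (config_step \<beta> p S) g =
    ((\<Sum>x\<in>descents S. \<beta> * v x + (1 - \<beta>) * ((1 - p) * g (set_pair S x False True) + p * g S))
    + (\<Sum>x\<in>ascents S. \<beta> * v x + (1 - \<beta>) * (p * g (set_pair S x True False) + (1 - p) * g S)))
    / (2 * real (card (ascents S)) + 1)"
proof -
  let ?U = "unlike_pairs S"
  have U: "finite ?U" "?U \<noteq> {}" by (simp_all add: finite_unlike_pairs unlike_pairs_nonempty)
  define E where "E b x = measure_pmf.expectation (if b then voter_move S x else exclusion_move p S x) g" for b x
  have fin: "finite (set_pmf (if b then voter_move S x else exclusion_move p S x))" for b x
    by (simp add: finite_set_voter_move finite_set_exclusion_move)
  have card: "real (card ?U) = 2 * real (card (ascents S)) + 1"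
    unfolding unlike_pairs_split
    by (subst card_Un_disjoint) (auto simp: unlike_pairs_split(2) card_descents)
  have "measure_pmf.expectation (config_step \<beta> p S) g
      = \<beta> * (\<Sum>x\<in>?U. E True x / card ?U) + (1 - \<beta>) * (\<Sum>x\<in>?U. E False x / card ?U)"
    unfolding config_step_def
    using assms(1,2) U fin
    by (subst pmf_expectation_bind[of UNIV])
       (auto simp: UNIV_bool pmf_expectation_bind_pmf_of_set E_def divide_inverse mult.commute
             finite_set_voter_move finite_set_exclusion_move set_pmf_of_set)
  also have "\<dots> = (\<Sum>x\<in>?U. \<beta> * E True x + (1 - \<beta>) * E False x) / card ?U"
    by (simp add: sum_divide_distrib[symmetric] sum.distrib sum_distrib_left add_divide_distrib)
  also have "(\<Sum>x\<in>?U. \<beta> * E True x + (1 - \<beta>) * E False x)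
      = (\<Sum>x\<in>descents S. \<beta> * E True x + (1 - \<beta>) * E False x) + (\<Sum>x\<in>ascents S. \<beta> * E True x + (1 - \<beta>) * E False x)"
    unfolding unlike_pairs_split(1) by (subst sum.union_disjoint) (auto simp: unlike_pairs_split(2))
  also have "(\<Sum>x\<in>descents S. \<beta> * E True x + (1 - \<beta>) * E False x)
      = (\<Sum>x\<in>descents S. \<beta> * v x + (1 - \<beta>) * ((1 - p) * g (set_pair S x False True) + p * g S))"
    using assms(3,4) by (intro sum.cong) (auto simp: E_def v_def voter_move_def exclusion_move_def descents_def algebra_simps)
  also have "(\<Sum>x\<in>ascents S. \<beta> * E True x + (1 - \<beta>) * E False x)
      = (\<Sum>x\<in>ascents S. \<beta> * v x + (1 - \<beta>) * (p * g (set_pair S x True False) + (1 - p) * g S))"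
    using assms(3,4) by (intro sum.cong) (auto simp: E_def v_def voter_move_def exclusion_move_def ascents_def algebra_simps)
  finally show ?thesis unfolding card .
qed

text \<open>The voter part vanishes because ascents and descents have the same total height. In the exclusion part a
  descent moves the span up by \<open>h + 1\<close> with probability \<open>1 - p\<close>, and an ascent moves it down by \<open>h - 1\<close> with
  probability \<open>p\<close>.\<close>

lemma expectation_inversion_span:
  fixes S :: config
  assumes "0 \<le> \<beta>" "\<beta> \<le> 1" "0 \<le> p" "p \<le> 1"
  defines "N \<equiv> real (card (ascents S))" and "H \<equiv> real_of_int (sum (height S) (ascents S))"
  shows "measure_pmf.expectation (config_step \<beta> p S) (\<lambda>S. real_of_int (inversion_span S))
    = real_of_int (inversion_span S) + (1 - \<beta>) * ((1 - 2 * p) * H + N + (1 - p)) / (2 * N + 1)"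
proof -
  let ?s = "\<lambda>S. real_of_int (inversion_span S)"
  define h where "h x = real_of_int (height S x)" for x
  have sum_h: "sum h (ascents S) = H" "sum h (descents S) = H"
    using sum_height_descents[of S] by (simp_all add: h_def[abs_def] H_def flip: of_int_add of_int_sum)
  have voter: "?s (set_pair S x True True) + ?s (set_pair S x False False) = 2 * ?s S + (if label S x then h x else - h x)"
    if "x \<in> unlike_pairs S" for x
    using arg_cong[OF inversion_span_voter[OF that], of real_of_int] by (simp add: h_def split: if_splits)
  have excl: "?s (set_pair S x (\<not> label S x) (label S x)) = ?s S + 1 + (if label S x then h x else - h x)"
    if "x \<in> unlike_pairs S" for x
    using arg_cong[OF inversion_span_exclusion[OF that], of real_of_int] by (simp add: h_def split: if_splits)
  have "\<beta> * ((?s (set_pair S x True True) + ?s (set_pair S x False False)) / 2)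
      + (1 - \<beta>) * ((1 - p) * ?s (set_pair S x False True) + p * ?s S)
      = ?s S + (1 - \<beta>) * (1 - p) + (\<beta> / 2 + (1 - \<beta>) * (1 - p)) * h x" if "x \<in> descents S" for x
  proof -
    have "(?s (set_pair S x True True) + ?s (set_pair S x False False)) / 2 = ?s S + h x / 2"
      and "?s (set_pair S x False True) = ?s S + 1 + h x"
      using voter[of x] excl[of x] that by (simp_all add: descents_def unlike_pairs_def)
    then show ?thesis by (simp only:) (simp add: algebra_simps)
  qed
  then have D: "(\<Sum>x\<in>descents S. \<beta> * ((?s (set_pair S x True True) + ?s (set_pair S x False False)) / 2)
      + (1 - \<beta>) * ((1 - p) * ?s (set_pair S x False True) + p * ?s S))
      = (N + 1) * (?s S + (1 - \<beta>) * (1 - p)) + (\<beta> / 2 + (1 - \<beta>) * (1 - p)) * H"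
    by (simp add: sum.distrib sum_distrib_left[symmetric] card_descents N_def sum_h)
  have "\<beta> * ((?s (set_pair S x True True) + ?s (set_pair S x False False)) / 2)
      + (1 - \<beta>) * (p * ?s (set_pair S x True False) + (1 - p) * ?s S)
      = ?s S + (1 - \<beta>) * p + (- \<beta> / 2 - (1 - \<beta>) * p) * h x" if "x \<in> ascents S" for x
  proof -
    have "(?s (set_pair S x True True) + ?s (set_pair S x False False)) / 2 = ?s S - h x / 2"
      and "?s (set_pair S x True False) = ?s S + 1 - h x"
      using voter[of x] excl[of x] that by (simp_all add: ascents_def unlike_pairs_def)
    then show ?thesis by (simp only:) (simp add: algebra_simps)
  qed
  then have A: "(\<Sum>x\<in>ascents S. \<beta> * ((?s (set_pair S x True True) + ?s (set_pair S x False False)) / 2)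
      + (1 - \<beta>) * (p * ?s (set_pair S x True False) + (1 - p) * ?s S))
      = N * (?s S + (1 - \<beta>) * p) + (- \<beta> / 2 - (1 - \<beta>) * p) * H"
    by (simp add: sum.distrib sum_distrib_left[symmetric] N_def sum_h)
  have "N \<ge> 0" by (simp add: N_def)
  then show ?thesis
    unfolding expectation_config_step[OF assms(1-4)] A D N_def[symmetric]
    by (simp add: field_simps)
qed

lemma expectation_inversions_voter:
  fixes p :: real and S :: config
  assumes "0 \<le> p" "p \<le> 1"
  defines "N \<equiv> real (card (ascents S))"
  shows "measure_pmf.expectation (config_step 1 p S) (\<lambda>S. real_of_int (inversions S))
    = real_of_int (inversions S) - N / (2 * N + 1)"
proof -
  let ?s = "\<lambda>S. real_of_int (inversions S)"
  have voter: "(?s (set_pair S x True True) + ?s (set_pair S x False False)) / 2 = ?s S - (if label S x then 0 else 1)"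
    if "x \<in> unlike_pairs S" for x
    using arg_cong[OF inversions_voter[OF that], of real_of_int] by (auto simp: field_simps)
  have D: "(\<Sum>x\<in>descents S. (?s (set_pair S x True True) + ?s (set_pair S x False False)) / 2) = (N + 1) * ?s S"
    using voter by (simp add: descents_def unlike_pairs_def card_descents[unfolded descents_def] N_def)
  have A: "(\<Sum>x\<in>ascents S. (?s (set_pair S x True True) + ?s (set_pair S x False False)) / 2) = N * (?s S - 1)"
    using voter by (simp add: ascents_def unlike_pairs_def N_def)
  have "N \<ge> 0" by (simp add: N_def)
  then show ?thesis
    using expectation_config_step[of 1 p S ?s] assms(1,2)
    by (simp add: A D N_def[symmetric]) (simp add: field_simps)
qed

lemma expectation_transition:
  fixes f :: "config_class \<Rightarrow> real"
  shows
  "measure_pmf.expectation (transition \<beta> p (class_of S)) f = measure_pmf.expectation (config_step \<beta> p S) (\<lambda>S. f (class_of S))"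
  by (simp add: transition.abs_eq)

lemma class_pos:
  assumes "S \<noteq> ground_state"
  shows "1 \<le> class_inversions S" "1 \<le> class_span S"
proof -
  obtain R where R: "S = class_of R" by (induction S) auto
  have "ascents R \<noteq> {}" using ground_state_if_no_ascents assms R by auto
  then show "1 \<le> class_inversions S" "1 \<le> class_span S"
    using inversions_pos[of R] inversion_span_pos[of R]
    by (simp_all add: R class_inversions.abs_eq class_span.abs_eq)
qed

lemma class_nonneg: "0 \<le> class_inversions S" "0 \<le> class_span S"
  by (induction S) (simp_all add: class_inversions.abs_eq class_span.abs_eq inversions_nonneg inversion_span_nonneg)

lemma class_inversions_le: "S \<noteq> ground_state \<Longrightarrow> class_inversions S \<le> 4 * class_span S powr (2 / 3)"
proof -
  obtain R where R: "S = class_of R" by (induction S) auto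
  assume "S \<noteq> ground_state"
  then have "0 < inversion_span R" using class_pos(2)[of S] by (simp add: R class_span.abs_eq)
  then show ?thesis using inversions_le_span[of R] by (simp add: R class_inversions.abs_eq class_span.abs_eq)
qed

lemma card_ascents_ratio:
  assumes "class_of S \<noteq> ground_state"
  shows "1 / 3 \<le> real (card (ascents S)) / (2 * real (card (ascents S)) + 1)"
proof -
  have "card (ascents S) \<noteq> 0" using ground_state_if_no_ascents[of S] assms by auto
  then have "1 \<le> real (card (ascents S))" by (simp del: card_0_eq)
  then show ?thesis by (simp add: field_simps)
qed

lemma class_span_drift:
  assumes "0 \<le> \<beta>" "\<beta> \<le> 1" "1 / 2 \<le> p" "p \<le> 1" and S: "S \<noteq> ground_state"
  shows "measure_pmf.expectation (transition \<beta> p S) class_span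
    \<le> class_span S + (1 - \<beta>) * (1 - (2 * p - 1) / 3 * class_span S powr (1 / 6))"
proof -
  obtain R where R: "S = class_of R" by (induction S) auto
  define N H where "N = real (card (ascents R))" and "H = real_of_int (sum (height R) (ascents R))"
  have N0: "0 \<le> N" by (simp add: N_def)
  have "1 / 3 \<le> N / (2 * N + 1)" unfolding N_def by (rule card_ascents_ratio) (use R S in simp)
  then have "0 < N" using N0 by (cases "N = 0") auto
  then have "class_span S powr (1 / 6) \<le> 3 * (H / (2 * N + 1))"
    using inversion_span_le_height_ratio[of R] by (simp add: N_def H_def R class_span.abs_eq)
  then have "(2 * p - 1) / 3 * class_span S powr (1 / 6) \<le> (2 * p - 1) / 3 * (3 * (H / (2 * N + 1)))"
    using assms by (intro mult_left_mono) auto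
  moreover have "(N + (1 - p)) / (2 * N + 1) \<le> 1" using N0 assms by (simp add: field_simps)
  ultimately have "(N + (1 - p)) / (2 * N + 1) - (2 * p - 1) / 3 * (3 * (H / (2 * N + 1)))
      \<le> 1 - (2 * p - 1) / 3 * class_span S powr (1 / 6)"
    by (rule diff_mono[rotated])
  moreover have "((1 - 2 * p) * H + N + (1 - p)) / d
      = (N + (1 - p)) / d - (2 * p - 1) / 3 * (3 * (H / d))" for d
    by (simp add: add_divide_distrib diff_divide_distrib left_diff_distrib)
  ultimately have "((1 - 2 * p) * H + N + (1 - p)) / (2 * N + 1) \<le> 1 - (2 * p - 1) / 3 * class_span S powr (1 / 6)"
    by (simp only:)
  then have "(1 - \<beta>) * (((1 - 2 * p) * H + N + (1 - p)) / (2 * N + 1)) \<le> (1 - \<beta>) * (1 - (2 * p - 1) / 3 * class_span S powr (1 / 6))"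
    using assms by (intro mult_left_mono) auto
  moreover have "measure_pmf.expectation (transition \<beta> p S) class_span
      = class_span S + (1 - \<beta>) * (((1 - 2 * p) * H + N + (1 - p)) / (2 * N + 1))"
    using assms unfolding R expectation_transition class_span.abs_eq N_def H_def
    by (subst expectation_inversion_span) auto
  ultimately show ?thesis by simp
qed

text \<open>At least one third of the unlike pairs are ascents, and at an ascent an exclusion move lowers the
  span with probability at least one half. This keeps the chain from being stuck among small
  configurations, where the drift of the span may be positive.\<close>

lemma class_span_descent:
  assumes "0 \<le> \<beta>" "\<beta> \<le> 1" "1 / 2 \<le> p" "p \<le> 1" and S: "S \<noteq> ground_state"
    and t: "0 < t" "t \<le> 1"
  shows "(1 - \<beta>) / 6 * t powr (class_span S - 1) \<le> measure_pmf.expectation (transition \<beta> p S) (\<lambda>S. t powr class_span S)"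
proof -
  obtain R where R: "S = class_of R" by (induction S) auto
  define N where "N = real (card (ascents R))"
  let ?g = "\<lambda>S. t powr real_of_int (inversion_span S)"
  have N0: "0 \<le> N" by (simp add: N_def)
  have third: "1 / 3 \<le> N / (2 * N + 1)" unfolding N_def by (rule card_ascents_ratio) (use R S in simp)
  define v where "v x = (?g (set_pair R x True True) + ?g (set_pair R x False False)) / 2" for x
  have v: "0 \<le> v x" for x by (simp add: v_def)
  have step: "(1 - \<beta>) * (1 / 2 * t powr (class_span S - 1)) \<le> \<beta> * v x + (1 - \<beta>) * (p * ?g (set_pair R x True False) + (1 - p) * ?g R)"
    if x: "x \<in> ascents R" for x
  proof -
    have "inversion_span (set_pair R x True False) \<le> inversion_span R - 1"
      using inversion_span_exclusion[of x R] height_ascent[OF x] x by (simp add: ascents_def unlike_pairs_def)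
    then have "real_of_int (inversion_span (set_pair R x True False)) \<le> class_span S - 1"
      by (simp add: R class_span.abs_eq)
    then have "t powr (class_span S - 1) \<le> ?g (set_pair R x True False)"
      using t by (intro powr_mono') auto
    then have "1 / 2 * t powr (class_span S - 1) \<le> p * ?g (set_pair R x True False)"
      using assms by (intro mult_mono) auto
    also have "\<dots> \<le> p * ?g (set_pair R x True False) + (1 - p) * ?g R"
      using assms by simp
    finally have "(1 - \<beta>) * (1 / 2 * t powr (class_span S - 1)) \<le> (1 - \<beta>) * (p * ?g (set_pair R x True False) + (1 - p) * ?g R)"
      using assms by (intro mult_left_mono) auto
    then show ?thesis using assms v[of x] by (simp add: add_increasing)
  qed
  have "(1 - \<beta>) / 6 * t powr (class_span S - 1) \<le> (N / (2 * N + 1)) * ((1 - \<beta>) * (1 / 2 * t powr (class_span S - 1)))"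
    using mult_right_mono[OF third, of "(1 - \<beta>) * (1 / 2 * t powr (class_span S - 1))"] assms by simp
  also have "\<dots> = (0 + (\<Sum>x\<in>ascents R. (1 - \<beta>) * (1 / 2 * t powr (class_span S - 1)))) / (2 * N + 1)"
    by (simp add: N_def)
  also have "\<dots> \<le> ((\<Sum>x\<in>descents R. \<beta> * v x + (1 - \<beta>) * ((1 - p) * ?g (set_pair R x False True) + p * ?g R))
    + (\<Sum>x\<in>ascents R. \<beta> * v x + (1 - \<beta>) * (p * ?g (set_pair R x True False) + (1 - p) * ?g R))) / (2 * N + 1)"
    using N0 assms v by (intro divide_right_mono add_mono sum_mono step sum_nonneg add_nonneg_nonneg mult_nonneg_nonneg) auto
  also have "\<dots> = measure_pmf.expectation (transition \<beta> p S) (\<lambda>S. t powr class_span S)"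
    using assms unfolding R expectation_transition class_span.abs_eq v_def N_def
    by (subst expectation_config_step) auto
  finally show ?thesis .
qed

section \<open>Lyapunov functions\<close>

text \<open>The span itself has a drift of the right order when it is large. The bounded correction
  \<open>C * (1 - t powr span)\<close> with small \<open>t\<close> always decreases on average, and a large \<open>C\<close> makes it outweigh the
  bounded positive drift of the span below the threshold \<open>s0\<close>.\<close>

lemma exclusion_lyapunov:
  assumes "0 \<le> \<beta>" "\<beta> < 1" "1 / 2 < p" "p \<le> 1"
  obtains F :: "config_class \<Rightarrow> real" and c where "0 < c" "\<And>S. 0 \<le> F S" "\<And>S. S \<noteq> ground_state \<Longrightarrow> 0 < F S"
    "\<And>S. S \<noteq> ground_state \<Longrightarrow> measure_pmf.expectation (transition \<beta> p S) F \<le> F S - c * F S powr (1 / 6)"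
proof -
  define D a t where "D = 1 - \<beta>" and "a = (2 * p - 1) / 3" and "t = (1 - \<beta>) / 12"
  have D: "0 < D" and a: "0 < a" and t: "0 < t" "t \<le> 1" using assms by (auto simp: D_def a_def t_def)
  define s0 where "s0 = (2 / a) powr 6"
  define C where "C = D / t powr s0"
  have C: "0 < C" using D t by (simp add: C_def)
  define F where "F S = class_span S + C * (1 - t powr class_span S)" for S
  define c where "c = D * a / 2 / (1 + C)"
  have le1: "t powr class_span S \<le> 1" for S using t class_nonneg by (intro powr_le1) auto
  have F: "class_span S \<le> F S" "F S \<le> class_span S + C" for S
    using le1[of S] C mult_left_mono[of "1 - t powr class_span S" 1 C] by (auto simp: F_def)
  show ?thesis
  proof (rule that[of c F])
    show "0 < c" using D a C by (simp add: c_def)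
    show "0 \<le> F S" for S using F(1)[of S] class_nonneg(2)[of S] by linarith
    show "0 < F S" if "S \<noteq> ground_state" for S using F(1)[of S] class_pos(2)[OF that] by linarith
    fix S assume S: "S \<noteq> ground_state"
    define s where "s = class_span S"
    have s: "1 \<le> s" using class_pos(2)[OF S] by (simp add: s_def)
    note int = integrable_measure_pmf_finite[OF finite_set_transition]
    \<comment> \<open>The value of \<open>t\<close> is small enough that one step down outweighs all possible gains.\<close>
    have "2 * t powr s = (1 - \<beta>) / 6 * t powr (s - 1)"
      using t by (simp add: powr_diff t_def)
    then have up: "2 * t powr s \<le> measure_pmf.expectation (transition \<beta> p S) (\<lambda>S. t powr class_span S)"
      using class_span_descent[of \<beta> p S t] assms S t by (simp add: s_def)
    have span: "measure_pmf.expectation (transition \<beta> p S) class_span \<le> s + D * (1 - a * s powr (1 / 6))"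
      using class_span_drift[of \<beta> p S] assms S by (simp add: s_def D_def a_def)
    have "measure_pmf.expectation (transition \<beta> p S) F
        = measure_pmf.expectation (transition \<beta> p S) class_span
          + C * (1 - measure_pmf.expectation (transition \<beta> p S) (\<lambda>S. t powr class_span S))"
      unfolding F_def by (simp add: int)
    also have "\<dots> \<le> (s + D * (1 - a * s powr (1 / 6))) + C * (1 - 2 * t powr s)"
      using span up C by (intro add_mono mult_left_mono) auto
    also have "\<dots> = F S + (D * (1 - a * s powr (1 / 6)) - C * t powr s)"
      by (simp add: F_def s_def algebra_simps)
    also have "\<dots> \<le> F S + - (D * a / 2) * s powr (1 / 6)"
    proof (rule add_left_mono, cases "s \<le> s0")
      case True
      then have "t powr s0 \<le> t powr s" using t by (intro powr_mono') auto
      then have "C * t powr s0 \<le> C * t powr s" using C by (intro mult_left_mono) auto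
      then have "D \<le> C * t powr s" using t by (simp add: C_def)
      moreover have "0 \<le> D * a * s powr (1 / 6)" using D a by simp
      ultimately show "D * (1 - a * s powr (1 / 6)) - C * t powr s \<le> - (D * a / 2) * s powr (1 / 6)"
        by (simp add: algebra_simps)
    next
      case False
      \<comment> \<open>Beyond \<open>s0\<close> at least half of the negative drift remains.\<close>
      have "2 / a = s0 powr (1 / 6)" using a unfolding s0_def by (simp only: powr_powr) simp
      also have "\<dots> \<le> s powr (1 / 6)" using False by (intro powr_mono2) (auto simp: s0_def)
      finally have "1 \<le> a / 2 * s powr (1 / 6)" using a by (simp add: field_simps)
      then have "D * 1 \<le> D * (a / 2 * s powr (1 / 6))" using D by (intro mult_left_mono) auto
      moreover have "0 \<le> C * t powr s" using C by simp
      ultimately show "D * (1 - a * s powr (1 / 6)) - C * t powr s \<le> - (D * a / 2) * s powr (1 / 6)"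
        by (simp add: algebra_simps)
    qed
    also have "\<dots> \<le> F S - c * F S powr (1 / 6)"
    proof -
      have "F S \<le> (1 + C) * s" using F(2)[of S] mult_left_mono[of 1 s C] s C
        unfolding s_def[symmetric] distrib_right by linarith
      then have "F S powr (1 / 6) \<le> ((1 + C) * s) powr (1 / 6)"
        using F(1)[of S] s by (intro powr_mono2) (auto simp: s_def)
      also have "\<dots> = (1 + C) powr (1 / 6) * s powr (1 / 6)"
        using C s by (simp add: powr_mult)
      also have "\<dots> \<le> (1 + C) powr 1 * s powr (1 / 6)"
        using C by (intro mult_right_mono powr_mono) auto
      finally have "c * F S powr (1 / 6) \<le> c * ((1 + C) * s powr (1 / 6))"
        using C D a by (intro mult_left_mono) (auto simp: c_def)
      also have "\<dots> = c * (1 + C) * s powr (1 / 6)" by (simp only: mult.assoc)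
      also have "c * (1 + C) = D * a / 2"
        using C unfolding c_def by (subst nonzero_eq_divide_eq[symmetric]) simp_all
      finally show ?thesis by simp
    qed
    finally show "measure_pmf.expectation (transition \<beta> p S) F \<le> F S - c * F S powr (1 / 6)" .
  qed
qed

text \<open>The weighted geometric mean is concave, hence below its tangent at \<open>(u, v)\<close>.\<close>

lemma weighted_geometric_tangent:
  fixes x y u v a :: real
  assumes "0 \<le> x" "0 \<le> y" "0 < u" "0 < v" "0 \<le> a" "a \<le> 1"
  shows "x powr a * y powr (1 - a) \<le> u powr a * v powr (1 - a) * (a * (x / u) + (1 - a) * (y / v))"
proof (cases "x = 0 \<or> y = 0")
  case True
  then have "x powr a * y powr (1 - a) = 0" by auto
  moreover have "0 \<le> u powr a * v powr (1 - a) * (a * (x / u) + (1 - a) * (y / v))"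
    using assms by simp
  ultimately show ?thesis by linarith
next
  case False
  then have xy: "0 < x" "0 < y" using assms by auto
  have "(x / u) powr a * (y / v) powr (1 - a) \<le> a * (x / u) + (1 - a) * (y / v)"
    using assms xy by (intro Youngs_inequality_0) auto
  then have "u powr a * v powr (1 - a) * ((x / u) powr a * (y / v) powr (1 - a))
      \<le> u powr a * v powr (1 - a) * (a * (x / u) + (1 - a) * (y / v))"
    by (intro mult_left_mono) auto
  moreover have "u powr a * v powr (1 - a) * ((x / u) powr a * (y / v) powr (1 - a)) = x powr a * y powr (1 - a)"
    using assms xy by (simp add: powr_divide)
  ultimately show ?thesis by simp
qed

text \<open>Under voter moves alone the span has no drift and the number \<open>u\<close> of inversions loses at least
  \<open>1 / 3\<close> on average. The weighted geometric mean inherits a drift \<open>- F / (5 * u)\<close>, because expectations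
  may be taken inside a concave function. Since \<open>u \<le> 4 * v powr (2 / 3)\<close> for the span \<open>v\<close>, the quotient is at
  least of order \<open>F powr (1 / 6)\<close>.\<close>

lemma voter_lyapunov:
  assumes "0 \<le> p" "p \<le> 1" "S \<noteq> ground_state"
  defines "F \<equiv> \<lambda>S. class_inversions S powr (3 / 5) * class_span S powr (2 / 5)"
  shows "measure_pmf.expectation (transition 1 p S) F \<le> F S - 1 / 10 * F S powr (1 / 6)"
proof -
  define u v where "u = class_inversions S" and "v = class_span S"
  have uv: "1 \<le> u" "1 \<le> v" using class_pos[OF assms(3)] by (simp_all add: u_def v_def)
  obtain R where R: "S = class_of R" by (induction S) auto
  note int = integrable_measure_pmf_finite[OF finite_set_transition]
  have "measure_pmf.expectation (transition 1 p S) class_inversions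
      = u - real (card (ascents R)) / (2 * real (card (ascents R)) + 1)"
    using assms unfolding u_def R expectation_transition class_inversions.abs_eq
    by (subst expectation_inversions_voter) auto
  then have Eu: "measure_pmf.expectation (transition 1 p S) class_inversions \<le> u - 1 / 3"
    using card_ascents_ratio[of R] assms(3) by (simp add: R)
  have Ev: "measure_pmf.expectation (transition 1 p S) class_span = v"
    using assms unfolding v_def R expectation_transition class_span.abs_eq
    by (subst expectation_inversion_span) auto
  have "measure_pmf.expectation (transition 1 p S) F
      \<le> measure_pmf.expectation (transition 1 p S) (\<lambda>T. F S * (3 / 5 * (class_inversions T / u) + 2 / 5 * (class_span T / v)))"
  proof (intro integral_mono int)
    show "F T \<le> F S * (3 / 5 * (class_inversions T / u) + 2 / 5 * (class_span T / v))" for T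
      using weighted_geometric_tangent[of "class_inversions T" "class_span T" u v "3 / 5"] uv class_nonneg[of T]
      by (simp add: F_def u_def v_def)
  qed
  also have "\<dots> = F S * (3 / 5 * (measure_pmf.expectation (transition 1 p S) class_inversions / u) + 2 / 5)"
    using Ev uv by (simp add: int)
  also have "\<dots> \<le> F S * (3 / 5 * ((u - 1 / 3) / u) + 2 / 5)"
    using Eu uv by (intro mult_left_mono add_mono divide_right_mono) (auto simp: F_def)
  also have "\<dots> = F S - F S / (5 * u)"
    using uv by (simp add: field_simps)
  also have "\<dots> \<le> F S - 1 / 10 * F S powr (1 / 6)"
  proof -
    have "u powr (1 / 2) \<le> (4 * v powr (2 / 3)) powr (1 / 2)"
      using class_inversions_le[OF assms(3)] uv by (intro powr_mono2) (auto simp: u_def v_def)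
    also have "\<dots> = 4 powr (1 / 2) * v powr (1 / 3)" using uv by (simp add: powr_mult powr_powr)
    also have "4 powr (1 / 2) = (2::real)" by (simp add: powr_half_sqrt)
    finally have "u powr (1 / 2) * u powr (1 / 2) \<le> u powr (1 / 2) * (2 * v powr (1 / 3))"
      by (intro mult_left_mono) auto
    moreover have "u powr (1 / 2) * u powr (1 / 2) = u"
      using uv by (simp add: powr_add[symmetric])
    \<comment> \<open>The exponents satisfy \<open>3 / 5 = 1 / 2 + 1 / 10\<close> and \<open>2 / 5 = 1 / 3 + 1 / 15\<close>.\<close>
    moreover have F: "F S = (u powr (1 / 2) * v powr (1 / 3)) * F S powr (1 / 6)"
      using uv by (simp add: F_def u_def[symmetric] v_def[symmetric] powr_mult powr_powr powr_add[symmetric] mult_ac)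
    ultimately have "u / 2 * F S powr (1 / 6) \<le> F S"
      using mult_right_mono[of "u / 2" "u powr (1 / 2) * v powr (1 / 3)" "F S powr (1 / 6)"] by simp
    then show ?thesis using uv by (simp add: field_simps)
  qed
  finally show ?thesis .
qed

section \<open>The moment of order 6/5\<close>

theorem theorem6:
  fixes M :: "'a measure" and \<beta> p :: real
    and \<xi> :: "nat \<Rightarrow> 'a \<Rightarrow> config_class" and S\<^sub>0 :: config_class
  assumes "0 \<le> \<beta>" and "\<beta> \<le> 1" and "1 / 2 < p" and "p \<le> 1"
    and "exclusion_voter_process M \<beta> p \<xi>"
    and "\<P>(\<omega> in M. \<xi> 0 \<omega> = S\<^sub>0) > 0"
  shows "cond_nn_expectation M (\<lambda>\<omega>. enat_powr (relaxation_time (\<lambda>t. \<xi> t \<omega>)) (6 / 5))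
           (\<lambda>\<omega>. \<xi> 0 \<omega> = S\<^sub>0) < \<infinity>"
proof -
  have "\<exists>(F :: config_class \<Rightarrow> real) c. 0 < c \<and> (\<forall>S. 0 \<le> F S) \<and> (\<forall>S. S \<noteq> ground_state \<longrightarrow> 0 < F S \<and>
      measure_pmf.expectation (transition \<beta> p S) F \<le> F S - c * F S powr (1 / 6))"
  proof (cases "\<beta> = 1")
    case True
    let ?F = "\<lambda>S. class_inversions S powr (3 / 5) * class_span S powr (2 / 5)"
    have "0 < ?F S" if "S \<noteq> ground_state" for S
      using class_pos[OF that] by (intro mult_pos_pos) auto
    then show ?thesis
      using voter_lyapunov[of p] assms(3,4) True by (intro exI[of _ ?F] exI[of _ "1 / 10"]) auto
  next
    case False
    then have "\<beta> < 1" using assms by simp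
    then show ?thesis
      using exclusion_lyapunov[of \<beta> p] assms by metis
  qed
  then obtain F :: "config_class \<Rightarrow> real" and c where "0 < c" "\<And>S. 0 \<le> F S" "\<And>S. S \<noteq> ground_state \<Longrightarrow> 0 < F S"
    "\<And>S. S \<noteq> ground_state \<Longrightarrow>
      measure_pmf.expectation (transition \<beta> p S) F \<le> F S - c * F S powr (1 - 1 / (6 / 5))"
    by force
  then show ?thesis
    using assms(6) exclusion_voter_process.relaxation_moment_if_drift[OF assms(5), of S\<^sub>0 F "6 / 5" c]
      finite_set_transition by simp
qed

end
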